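(* Let $0<\alpha<1$ and let $\beta\ge 1$ be an integer. There exist a constant $C_{\alpha,\beta}>0$ and an integer $k_0\ge 1$ such that for every integer $k\ge k_0$ the following holds. Let $\mathbb{A}\in\mathbb{R}^{N\times N}$ be a symmetric positive definite matrix, let $\Lambda>0$ be an upper bound for the eigenvalues of $\mathbb{A}$, let $\widetilde{\mathbf f}\in\mathbb{R}^N$, and let $\mathbf u=\mathbb{A}^{-\alpha}\widetilde{\mathbf f}$. Put $\mathcal{A}=\mathbb{A}/\Lambda$, $\mathbf f=\widetilde{\mathbf f}/\Lambda^{\alpha}$, and $\mathbf u_r=r_\alpha^\beta(\mathcal{A})\,\mathcal{A}^{-\beta}\mathbf f$, where $r_\alpha^\beta\in\mathcal{R}(k,k)$ is the best uniform rational approximation of $t^{\beta-\alpha}$ on $[0,1]$ from $\mathcal{R}(k,k)$. Then for every $\gamma\in\mathbb{R}$ $$\|\mathbf u_r-\mathbf u\|_{\mathbb{A}^{\gamma}}\le C_{\alpha,\beta}\,\Lambda^{\beta-\alpha}\,e^{-2\pi\sqrt{(\beta-\alpha)k}}\,\|\widetilde{\mathbf f}\|_{\mathbb{A}^{\gamma-2\beta}}.$$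
   Context: For integers $m,k\ge 0$, $\mathcal{R}(m,k)$ is the set of rational functions $r=P/Q$ with $P,Q$ real polynomials, $\deg P\le m$, $\deg Q\le k$, $Q$ not vanishing on $[0,1]$. For $0<\alpha<1$ and an integer $\beta\ge1$, the best uniform rational approximation $r_\alpha^\beta$ of $t^{\beta-\alpha}$ from $\mathcal{R}(m,k)$ is the minimizer over $r\in\mathcal{R}(m,k)$ of $\max_{t\in[0,1]}|t^{\beta-\alpha}-r(t)|$ (such a minimizer exists). For a symmetric positive definite matrix $\mathcal{M}\in\mathbb{R}^{N\times N}$, real powers $\mathcal{M}^{\gamma}$ and rational functions $r(\mathcal{M})$ are defined by the spectral decomposition, and $\|\mathbf v\|_{\mathcal{M}^\gamma}:=(\mathbf v^T\mathcal{M}^{\gamma}\mathbf v)^{1/2}$ for $\gamma\in\mathbb{R}$. *)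

theory Defs
  imports Complex_Main "Jordan_Normal_Form.Char_Poly"
begin

text \<open>The dimension of the matrices has to range inside the scope of the constants asserted by the
  theorem, so matrices and vectors are those of \<^theory>\<open>Jordan_Normal_Form.Matrix\<close>, whose
  dimension is a natural number rather than a type.\<close>

section \<open>Best uniform rational approximation on the unit interval\<close>

text \<open>Rational functions are functions on the reals. The values at zeros of \<open>Q\<close>, all outside
  \<open>[0,1]\<close>, are junk (division by zero) and are never used.\<close>

definition rational_functions :: "nat \<Rightarrow> nat \<Rightarrow> (real \<Rightarrow> real) set" where
  "rational_functions m k =
     {\<lambda>t. poly P t / poly Q t | P Q.
        degree P \<le> m \<and> degree Q \<le> k \<and> (\<forall>t\<in>{0..1}. poly Q t \<noteq> 0)}"

text \<open>For \<open>f\<close> and \<open>r\<close> continuous on \<open>[0,1]\<close> the supremum is a maximum.\<close>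

definition uniform_error :: "(real \<Rightarrow> real) \<Rightarrow> (real \<Rightarrow> real) \<Rightarrow> real" where
  "uniform_error f r = (SUP t\<in>{0..1}. \<bar>f t - r t\<bar>)"

definition best_rational_approx ::
    "nat \<Rightarrow> nat \<Rightarrow> (real \<Rightarrow> real) \<Rightarrow> (real \<Rightarrow> real) \<Rightarrow> bool" where
  "best_rational_approx m k f r \<longleftrightarrow>
     is_arg_min (uniform_error f) (\<lambda>s. s \<in> rational_functions m k) r"

section \<open>Functions of symmetric matrices\<close>

definition spd_mat :: "nat \<Rightarrow> real mat \<Rightarrow> bool" where
  "spd_mat n M \<longleftrightarrow> M \<in> carrier_mat n n \<and> transpose_mat M = M \<and>
     (\<forall>x\<in>carrier_vec n. x \<noteq> 0\<^sub>v n \<longrightarrow> x \<bullet> (M *\<^sub>v x) > 0)"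

text \<open>The columns of \<open>U\<close> are an orthonormal basis of eigenvectors with eigenvalues \<open>d 0, \<dots>, d (n-1)\<close>.
  The library's \<^const>\<open>orthogonal_mat\<close> is not used since it does not normalize the columns.\<close>

definition spectral_decomposition :: "real mat \<Rightarrow> real mat \<Rightarrow> (nat \<Rightarrow> real) \<Rightarrow> bool" where
  "spectral_decomposition M U d \<longleftrightarrow>
     (let n = dim_row M in
        U \<in> carrier_mat n n \<and> transpose_mat U * U = 1\<^sub>m n \<and> U * transpose_mat U = 1\<^sub>m n \<and>
        M = U * mat_diag n d * transpose_mat U)"

text \<open>The value does not depend on the spectral decomposition, see \<open>matrix_fun_eq\<close> below; for a matrix
  without one, i.e. a non-symmetric one, it is unspecified.\<close>

definition matrix_fun :: "(real \<Rightarrow> real) \<Rightarrow> real mat \<Rightarrow> real mat" where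
  "matrix_fun f M =
     (THE B. \<exists>U d. spectral_decomposition M U d \<and>
        B = U * mat_diag (dim_row M) (\<lambda>i. f (d i)) * transpose_mat U)"

definition matrix_powr :: "real mat \<Rightarrow> real \<Rightarrow> real mat" where
  "matrix_powr M \<gamma> = matrix_fun (\<lambda>x. x powr \<gamma>) M"

definition matrix_norm :: "real mat \<Rightarrow> real \<Rightarrow> real vec \<Rightarrow> real" where
  "matrix_norm M \<gamma> v = sqrt (v \<bullet> (matrix_powr M \<gamma> *\<^sub>v v))"

lemma spectral_decomposition_unique:
  assumes "spectral_decomposition M U d" and "spectral_decomposition M V e"
  shows "U * mat_diag (dim_row M) (\<lambda>i. f (d i)) * transpose_mat U =
         V * mat_diag (dim_row M) (\<lambda>i. f (e i)) * transpose_mat V"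
proof -
  define n where "n = dim_row M"
  define W where "W = transpose_mat V * U"
  have U: "U \<in> carrier_mat n n" "transpose_mat U * U = 1\<^sub>m n" "U * transpose_mat U = 1\<^sub>m n"
      "M = U * mat_diag n d * transpose_mat U"
    and V: "V \<in> carrier_mat n n" "transpose_mat V * V = 1\<^sub>m n" "V * transpose_mat V = 1\<^sub>m n"
      "M = V * mat_diag n e * transpose_mat V"
    using assms by (auto simp: spectral_decomposition_def Let_def n_def)
  note [simp] = U(1) V(1) 
  have Ut[simp]: "transpose_mat U \<in> carrier_mat n n" and Vt[simp]: "transpose_mat V \<in> carrier_mat n n"
    by auto
  note assoc = assoc_mult_mat[where n\<^sub>1 = n and n\<^sub>2 = n and n\<^sub>3 = n and n\<^sub>4 = n]
  have one: "1\<^sub>m n * B = B" "B * 1\<^sub>m n = B" if "B \<in> carrier_mat n n" for B :: "real mat"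
    using that by auto
  have mc: "A * B \<in> carrier_mat n n" if "A \<in> carrier_mat n n" "B \<in> carrier_mat n n" for A B :: "real mat"
    using that by (rule mult_carrier_mat)
  have W[simp]: "W \<in> carrier_mat n n" unfolding W_def by (intro mc Ut Vt U(1))
  have MU: "M * U = U * mat_diag n d"
    unfolding U(4) by (simp add: assoc mc U(2) one)
  have VM: "transpose_mat V * M = mat_diag n e * transpose_mat V"
  proof -
    have "transpose_mat V * M = (transpose_mat V * V) * (mat_diag n e * transpose_mat V)"
      unfolding V(4) by (simp add: assoc mc)
    then show ?thesis by (simp add: V(2) mc one)
  qed
  have M: "M \<in> carrier_mat n n" unfolding U(4) by (simp add: mc)
  have "W * mat_diag n d = transpose_mat V * (M * U)"
    by (simp add: W_def MU assoc mc)
  also have "\<dots> = mat_diag n e * W"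
    using M by (simp add: assoc[symmetric] VM W_def mc)
  finally have WD: "W * mat_diag n d = mat_diag n e * W" .
  have "W * mat_diag n (\<lambda>i. f (d i)) = mat_diag n (\<lambda>i. f (e i)) * W"
  proof (rule eq_matI)
    fix i j assume ij: "i < dim_row (mat_diag n (\<lambda>i. f (e i)) * W)"
      "j < dim_col (mat_diag n (\<lambda>i. f (e i)) * W)"
    then have ij: "i < n" "j < n" using W by (auto simp: mat_diag_def)
    have "(W * mat_diag n d) $$ (i,j) = (mat_diag n e * W) $$ (i,j)" using WD by simp
    then have "W $$ (i,j) * d j = e i * W $$ (i,j)"
      using ij by (simp add: mat_diag_mult_right[OF W] mat_diag_mult_left[OF W])
    then have "W $$ (i,j) = 0 \<or> d j = e i" by simp
    then show "(W * mat_diag n (\<lambda>i. f (d i))) $$ (i,j) = (mat_diag n (\<lambda>i. f (e i)) * W) $$ (i,j)"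
      using ij by (auto simp: mat_diag_mult_right[OF W] mat_diag_mult_left[OF W])
  qed (use carrier_matD[OF W] in \<open>simp_all add: mat_diag_def\<close>)
  then have eq: "V * (W * mat_diag n (\<lambda>i. f (d i))) * transpose_mat U =
      V * (mat_diag n (\<lambda>i. f (e i)) * W) * transpose_mat U" by simp
  have "V * (W * mat_diag n (\<lambda>i. f (d i))) * transpose_mat U =
      (V * transpose_mat V) * (U * mat_diag n (\<lambda>i. f (d i)) * transpose_mat U)"
    by (simp add: W_def assoc mc)
  moreover have "V * (mat_diag n (\<lambda>i. f (e i)) * W) * transpose_mat U =
      V * mat_diag n (\<lambda>i. f (e i)) * transpose_mat V * (U * transpose_mat U)"
    by (simp add: W_def assoc mc)
  ultimately show ?thesis
    using eq by (simp add: U(3) V(3) mc one n_def[symmetric])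
qed

lemma matrix_fun_eq:
  assumes "spectral_decomposition M U d"
  shows "matrix_fun f M = U * mat_diag (dim_row M) (\<lambda>i. f (d i)) * transpose_mat U"
  unfolding matrix_fun_def
  by (rule the_equality) (use assms spectral_decomposition_unique in blast)+

end

theory Submission
  imports "HOL-Complex_Analysis.Complex_Analysis" "HOL-Real_Asymp.Real_Asymp"
    "Jordan_Normal_Form.Spectral_Radius" Defs
begin

text \<open>
  In an orthonormal eigenbasis of \<open>A\<close> the error at the eigenvalue \<open>d = \<Lambda> t\<close> is the coordinate of \<open>ft\<close>
  multiplied by \<open>d\<^sup>-\<^sup>\<beta> \<Lambda>\<^sup>\<beta>\<^sup>-\<^sup>\<alpha> (r t - t\<^sup>\<beta>\<^sup>-\<^sup>\<alpha>)\<close>, so everything follows from a uniform bound for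
  \<open>\<bar>t\<^sup>a - r t\<bar>\<close> on \<open>[0,1]\<close>, where \<open>a = \<beta> - \<alpha>\<close> (lemma \<open>matrix_norm_error_le\<close>). Since \<open>r\<close> is a best
  approximation, it is enough to exhibit for every large \<open>k\<close> some rational function of type \<open>(k,k)\<close>
  with error at most \<open>C exp (- 2 \<pi> sqrt (a k))\<close> (lemma \<open>rational_approx_powr\<close>). This is the upper
  half, up to the constant, of Stahl's theorem on the approximation of \<open>t\<^sup>a\<close>; it has a short proof by
  quadrature.

  With \<open>s = exp (w / a)\<close> the Stieltjes representation of a power becomes
  \<open>(\<pi> a / sin (\<pi> a)) y\<^sup>a = \<integral> exp w \<cdot> y / (y + exp (w / a)) dw\<close> over the real line (for \<open>a > 1\<close> only modulo
  polynomials in \<open>y\<close>). A quadrature rule for this integral is a rational function of \<open>y\<close> with poles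
  \<open>- exp (w\<^sub>j / a)\<close>. Since the integrand is at most \<open>exp w\<close> and only a bounded error is wanted, the
  step may grow like \<open>1 / w\<close> towards small \<open>w\<close>: the nodes are \<open>w\<^sub>j = 2 \<pi> sqrt (a j)\<close>, the trapezoidal rule in
  the variable \<open>v = w\<^sup>2 / (4 \<pi>\<^sup>2 a)\<close>. Its error is a contour integral against \<open>1 / (1 - exp (- 2 \<pi> \<i> v))\<close>,
  which at \<open>w = p + \<i> q\<close> decays like \<open>exp (- p \<bar>q\<bar> / (\<pi> a))\<close>. The poles of the kernel nearest to the real
  axis have \<open>q = \<plusminus> \<pi> a\<close>. Stopping before them would leave an integrand of size 1 over a length that grows
  with \<open>y\<close>; on the lines \<open>q = \<plusminus> 2 \<pi> a\<close> beyond the poles the integrand is of size \<open>exp (- p)\<close> and its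
  integral is bounded, while the two residues give the main term \<open>y\<^sup>a\<close> and a bounded remainder
  (lemma \<open>trapezoid_error\<close>).

  The left edge of the contour contributes \<open>O(1)\<close>. The right edge does not, but there
  \<open>\<bar>exp (w / a)\<bar> \<ge> exp 1 \<cdot> y\<close>, so its contribution is a geometric series in \<open>y\<close>, and a polynomial of degree
  \<open>O(sqrt M)\<close> matches it up to \<open>O(1)\<close>, \<open>M\<close> being the number of nodes. Altogether \<open>y\<^sup>a\<close> is within
  \<open>O(1)\<close> of a rational function of type \<open>(M + O(sqrt M), M)\<close> on an interval \<open>[0,Y]\<close> with
  \<open>Y\<^sup>a\<close> of the order of \<open>exp (2 \<pi> sqrt (a M))\<close> (lemma \<open>power_approx_large_interval\<close>). Rescaling to
  \<open>[0,1]\<close> divides the error by \<open>Y\<^sup>a\<close>. The surplus degree \<open>k - M = O(sqrt k)\<close> changes \<open>sqrt k\<close> only by a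
  bounded amount (lemma \<open>node_diff_bounded\<close>), so it costs a constant factor and leaves the rate intact.
\<close>

section \<open>Residues in a rectangle\<close>

lemma contour_integral_linepath_vertical:
  assumes "s < t"
  shows "contour_integral (linepath (Complex u s) (Complex u t)) f = \<i> * integral {s..t} (\<lambda>q. f (Complex u q))"
    "contour_integral (linepath (Complex u t) (Complex u s)) f = - (\<i> * integral {s..t} (\<lambda>q. f (Complex u q)))"
  using contour_integral_linepath_same_Re[of "Complex u s" u "Complex u t" s t f] assms
    contour_integral_reversepath[of "linepath (Complex u s) (Complex u t)" f]
  by (auto simp: )

lemma contour_integral_linepath_horizontal:
  assumes "u < v"
  shows "contour_integral (linepath (Complex u s) (Complex v s)) f = integral {u..v} (\<lambda>p. f (Complex p s))"
    "contour_integral (linepath (Complex v s) (Complex u s)) f = - integral {u..v} (\<lambda>p. f (Complex p s))"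
proof -
  let ?l = "linepath (complex_of_real u) (complex_of_real v)"
  have shift: "linepath (Complex u s) (Complex v s) x = ?l x + Complex 0 s" for x
    by (auto simp: linepath_def complex_eq_iff algebra_simps)
  have diff: "Complex v s - Complex u s = complex_of_real v - complex_of_real u"
    by (simp add: complex_eq_iff)
  have "contour_integral (linepath (Complex u s) (Complex v s)) f
      = contour_integral ?l (\<lambda>z. f (z + Complex 0 s))"
    unfolding contour_integral_integral by (simp add: shift diff)
  also have "\<dots> = integral {u..v} (\<lambda>p. f (Complex p s))"
    using assms by (subst contour_integral_linepath_Reals_eq) (auto simp: Complex_eq algebra_simps)
  finally show *: "contour_integral (linepath (Complex u s) (Complex v s)) f = integral {u..v} (\<lambda>p. f (Complex p s))" .
  show "contour_integral (linepath (Complex v s) (Complex u s)) f = - integral {u..v} (\<lambda>p. f (Complex p s))"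
    using contour_integral_reversepath[of "linepath (Complex u s) (Complex v s)" f] * by simp
qed

text \<open>Edges are given as integrals over real intervals, since the estimates below treat every edge
  separately.\<close>

lemma rectangle_residue_theorem:
  fixes f :: "complex \<Rightarrow> complex"
  assumes uv: "u < v" and st: "s < t"
    and S: "open S" "connected S" "cbox (Complex u s) (Complex v t) \<subseteq> S"
    and pts: "finite pts" "f holomorphic_on S - pts"
    and avoid: "\<And>p. p \<in> pts \<Longrightarrow> p \<in> cbox (Complex u s) (Complex v t) \<Longrightarrow> p \<in> box (Complex u s) (Complex v t)"
  shows "integral {u..v} (\<lambda>p. f (Complex p s)) + \<i> * integral {s..t} (\<lambda>q. f (Complex v q))
       - integral {u..v} (\<lambda>p. f (Complex p t)) - \<i> * integral {s..t} (\<lambda>q. f (Complex u q))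
       = 2 * pi * \<i> * (\<Sum>p\<in>pts \<inter> box (Complex u s) (Complex v t). residue f p)"
proof -
  let ?a = "Complex u s" and ?b = "Complex v t"
  let ?g = "rectpath ?a ?b"
  have img: "path_image ?g = cbox ?a ?b - box ?a ?b"
    using uv st by (intro path_image_rectpath_cbox_minus_box) auto
  have sub: "path_image ?g \<subseteq> S - pts" using S(3) avoid by (auto simp: img)
  have cont: "continuous_on (path_image ?g) f"
    using pts(2) sub holomorphic_on_imp_continuous_on holomorphic_on_subset by blast
  have ci: "f contour_integrable_on linepath x y" if "closed_segment x y \<subseteq> path_image ?g" for x y
    using cont that by (intro contour_integrable_continuous_linepath) (rule continuous_on_subset)
  have segs: "closed_segment (Complex u s) (Complex v s) \<subseteq> path_image ?g"
     "closed_segment (Complex v s) (Complex v t) \<subseteq> path_image ?g"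
     "closed_segment (Complex v t) (Complex u t) \<subseteq> path_image ?g"
     "closed_segment (Complex u t) (Complex u s) \<subseteq> path_image ?g"
    by (auto simp: rectpath_def Let_def path_image_join)
  have "contour_integral ?g f = 
      contour_integral (linepath (Complex u s) (Complex v s)) f +
      (contour_integral (linepath (Complex v s) (Complex v t)) f +
      (contour_integral (linepath (Complex v t) (Complex u t)) f +
      contour_integral (linepath (Complex u t) (Complex u s)) f))"
    using segs by (simp add: rectpath_def Let_def ci)
  moreover have "contour_integral ?g f = 2 * pi * \<i> * (\<Sum>p\<in>pts. winding_number ?g p * residue f p)"
  proof (rule Residue_theorem[OF S(1,2) pts])
    show "\<forall>z. z \<notin> S \<longrightarrow> winding_number ?g z = 0"
      using S(3) uv st by (auto intro!: winding_number_rectpath_outside)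
  qed (use sub in auto)
  moreover have "(\<Sum>p\<in>pts. winding_number ?g p * residue f p) = 
     (\<Sum>p\<in>pts \<inter> box ?a ?b. residue f p)"
    using pts(1)
  proof (intro sum.mono_neutral_cong_right ballI)
    fix p assume "p \<in> pts - pts \<inter> box ?a ?b"
    then have "p \<notin> cbox ?a ?b" using avoid by auto
    then show "winding_number ?g p * residue f p = 0"
      using uv st by (simp add: winding_number_rectpath_outside)
  qed (auto simp: winding_number_rectpath)
  ultimately show ?thesis
    by (simp add: contour_integral_linepath_vertical[OF st] contour_integral_linepath_horizontal[OF uv] algebra_simps)
qed

section \<open>The nodes and the kernel\<close>

definition node :: "real \<Rightarrow> real \<Rightarrow> real" where
  "node a v = 2 * pi * sqrt (a * v)"

text \<open>With \<open>v = w\<^sup>2 / (4 \<pi>\<^sup>2 a)\<close>, the inverse of \<^const>\<open>node\<close>, this is \<open>exp (- 2 \<pi> \<i> v)\<close>.\<close>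

definition phase :: "real \<Rightarrow> complex \<Rightarrow> complex" where
  "phase a w = exp (- (\<i> * w\<^sup>2 / (2 * pi * a)))"

text \<open>This is \<open>s\<^sup>a\<^sup>-\<^sup>1 y / (y + s) ds\<close> in the variable \<open>w = a ln s\<close>, up to the factor \<open>a\<close>.\<close>

definition stieltjes_kernel :: "real \<Rightarrow> real \<Rightarrow> complex \<Rightarrow> complex" where
  "stieltjes_kernel a y w = exp w * y / (y + exp (w / a))"

lemma node_pos: "a > 0 \<Longrightarrow> v > 0 \<Longrightarrow> node a v > 0"
  by (simp add: node_def)

lemma node_mono: "a > 0 \<Longrightarrow> u < v \<Longrightarrow> node a u < node a v"
  by (simp add: node_def)

lemma node_squared: "a > 0 \<Longrightarrow> v \<ge> 0 \<Longrightarrow> (node a v)\<^sup>2 = 4 * pi\<^sup>2 * a * v"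
  by (simp add: node_def power_mult_distrib)

lemma phase_Complex:
  "phase a (Complex p q) = exp (Complex (p * q / (pi * a)) ((q\<^sup>2 - p\<^sup>2) / (2 * pi * a)))"
  unfolding phase_def
  by (rule arg_cong[where f = exp])
     (simp add: complex_eq_iff Re_divide Im_divide power2_eq_square field_simps)

lemma norm_phase: "norm (phase a w) = exp (Re w * Im w / (pi * a))"
  by (cases w) (simp add: phase_Complex)

lemma phase_eq_1_iff:
  assumes a: "a > 0" and w: "Re w > 0"
  shows "phase a w = 1 \<longleftrightarrow> (\<exists>j::nat. j \<ge> 1 \<and> w = node a j)"
proof
  assume *: "phase a w = 1"
  obtain p q where [simp]: "w = Complex p q" by (cases w)
  from * obtain n :: int where "p * q / (pi * a) = 0" and n: "(q\<^sup>2 - p\<^sup>2) / (2 * pi * a) = real_of_int (2 * n) * pi"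
    by (auto simp: phase_Complex exp_eq_1)
  then have [simp]: "q = 0" using a w by auto
  have p2: "p\<^sup>2 = 4 * pi\<^sup>2 * a * (- real_of_int n)"
    using n a by (simp add: field_simps power2_eq_square)
  have "p\<^sup>2 > 0" using w by simp
  then have "n < 0" unfolding p2 using a by (simp add: zero_less_mult_iff mult_less_0_iff)
  define m where "m = nat (- n)"
  then have m: "n = - int m" "m \<ge> 1" using \<open>n < 0\<close> by auto
  have "p\<^sup>2 = (node a m)\<^sup>2"
    using p2 a unfolding m(1) by (subst node_squared) auto
  then have "p = node a m"
    using w node_pos[OF a, of "real m"] m(2) by (simp add: power2_eq_iff)
  then show "\<exists>j::nat. j \<ge> 1 \<and> w = node a j"
    using m(2) by (auto intro!: exI[of _ m] simp: complex_eq_iff)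
next
  assume "\<exists>j::nat. j \<ge> 1 \<and> w = node a j"
  then obtain j :: nat where w: "w = Complex (node a j) 0" by (auto simp: complex_eq_iff)
  have "- (node a j)\<^sup>2 / (2 * pi * a) = real_of_int (2 * (- int j)) * pi"
    using a by (subst node_squared) (auto simp: field_simps power2_eq_square)
  then show "phase a w = 1"
    unfolding w phase_Complex exp_eq_1 by (intro conjI exI[of _ "- int j"]) auto
qed

text \<open>Half-way between two nodes the phase is negative on the real axis. Along the vertical line it turns
  only by a quarter of a circle before its modulus has left the interval \<open>[1/2, 2]\<close>.\<close>

lemma norm_one_minus_phase_ge_half:
  assumes a: "a > 0" and w: "Re w = node a (real j + 1/2)"
  shows "norm (1 - phase a w) \<ge> 1/2"
proof -
  define p q where "p = node a (real j + 1/2)" and "q = Im w"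
  have wpq: "w = Complex p q" using w by (simp add: complex_eq_iff p_def q_def)
  have p2: "p\<^sup>2 = 4 * pi\<^sup>2 * a * (j + 1/2)" using a by (simp add: p_def node_squared)
  have ph: "(q\<^sup>2 - p\<^sup>2) / (2 * pi * a) = q\<^sup>2 / (2 * pi * a) - pi + real_of_int (- int j) * (2 * pi)"
    using a unfolding p2 by (simp add: field_simps power2_eq_square)
  show ?thesis
  proof (cases "q\<^sup>2 \<le> pi\<^sup>2 * a")
    case True
    have "q\<^sup>2 / (2 * pi * a) \<le> pi / 2" using True a by (simp add: field_simps power2_eq_square)
    moreover have "q\<^sup>2 / (2 * pi * a) \<ge> 0" using a by simp
    ultimately have c: "cos (q\<^sup>2 / (2 * pi * a)) \<ge> 0" by (intro cos_ge_zero) auto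
    have "Re (phase a w) = exp (p * q / (pi * a)) * cos ((q\<^sup>2 - p\<^sup>2) / (2 * pi * a))"
      by (simp add: wpq phase_Complex Re_exp)
    also have "cos ((q\<^sup>2 - p\<^sup>2) / (2 * pi * a)) = - cos (q\<^sup>2 / (2 * pi * a))"
      unfolding ph using cos.periodic_simps(1) 
      by (metis cos_minus_pi cos_int_2pin cos_add sin_int_2pin mult.commute mult_1_right mult_zero_right diff_zero)
    finally have "Re (phase a w) \<le> 0" using c by (simp add: mult_nonneg_nonneg)
    then have "Re (1 - phase a w) \<ge> 1" by simp
    then show ?thesis using complex_Re_le_cmod[of "1 - phase a w"] by linarith
  next
    case False
    have "(p * q / (pi * a))\<^sup>2 = p\<^sup>2 * q\<^sup>2 / (pi\<^sup>2 * a\<^sup>2)" by (simp add: power_mult_distrib power_divide)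
    also have "\<dots> \<ge> (4 * pi\<^sup>2 * a * (1/2)) * (pi\<^sup>2 * a) / (pi\<^sup>2 * a\<^sup>2)"
      unfolding p2 using False a by (intro divide_right_mono mult_mono) auto
    also have "(4 * pi\<^sup>2 * a * (1/2)) * (pi\<^sup>2 * a) / (pi\<^sup>2 * a\<^sup>2) = 2 * pi\<^sup>2"
      using a by (simp add: field_simps power2_eq_square)
    also have "2 * pi\<^sup>2 \<ge> 1\<^sup>2" using one_le_power[of pi 2] pi_ge_two by (simp del: one_le_power)
    finally have "\<bar>p * q / (pi * a)\<bar> \<ge> 1"
      by (metis abs_le_square_iff abs_1)
    then have "p * q / (pi * a) \<ge> 1 \<or> p * q / (pi * a) \<le> -1" by linarith
    then show ?thesis
    proof
      assume "p * q / (pi * a) \<ge> 1"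
      then have "norm (phase a w) \<ge> 2"
        using exp_ge_add_one_self[of "p * q / (pi * a)"] by (simp only: norm_phase wpq complex.sel)
      then show ?thesis using norm_triangle_ineq3[of 1 "phase a w"] by auto
    next
      assume le: "p * q / (pi * a) \<le> -1"
      have "exp (p * q / (pi * a)) \<le> exp (-1)" using le by simp
      also have "exp (-1::real) \<le> 1/2" using exp_ge_add_one_self[of "1::real"] by (simp add: exp_minus field_simps)
      finally have "norm (phase a w) \<le> 1/2" by (simp add: norm_phase wpq)
      then show ?thesis using norm_triangle_ineq2[of 1 "phase a w"] by auto
    qed
  qed
qed

lemma stieltjes_kernel_pole_iff:
  assumes a: "a > 0" and y: "y > 0" and w: "\<bar>Im w\<bar> < 3 * pi * a"
  shows "complex_of_real y + exp (w / a) = 0 \<longleftrightarrow> w \<in> {Complex (a * ln y) (pi * a), Complex (a * ln y) (- (pi * a))}"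
proof -
  have "complex_of_real y + exp (w / a) = 0 \<longleftrightarrow> exp (w / a) = exp (Complex (ln y) pi)"
  proof -
    have "exp (Complex (ln y) pi) = - complex_of_real y"
      using y by (simp add: complex_eq_iff Re_exp Im_exp)
    then show ?thesis by (simp only: add_eq_0_iff)
  qed
  also have "\<dots> \<longleftrightarrow> (\<exists>n::int. w / a = Complex (ln y) pi + (of_int (2 * n) * pi) * \<i>)"
    by (rule exp_eq)
  also have "\<dots> \<longleftrightarrow> (\<exists>n::int. Re w = a * ln y \<and> Im w = a * pi * (2 * n + 1))"
    using a by (simp add: complex_eq_iff field_simps)
  also have "\<dots> \<longleftrightarrow> w \<in> {Complex (a * ln y) (pi * a), Complex (a * ln y) (- (pi * a))}"
  proof
    assume "\<exists>n::int. Re w = a * ln y \<and> Im w = a * pi * (2 * n + 1)"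
    then obtain n :: int where n: "Re w = a * ln y" "Im w = a * pi * (2 * n + 1)" by auto
    have "\<bar>a * pi * (2 * n + 1)\<bar> = pi * a * \<bar>2 * real_of_int n + 1\<bar>" using a by (simp add: abs_mult)
    then have "pi * a * \<bar>2 * real_of_int n + 1\<bar> < pi * a * 3" using w n(2) by (simp add: algebra_simps)
    then have "\<bar>2 * real_of_int n + 1\<bar> < 3" using a by (subst (asm) mult_less_cancel_left_pos) auto
    then have "n = 0 \<or> n = -1" by linarith
    then show "w \<in> {Complex (a * ln y) (pi * a), Complex (a * ln y) (- (pi * a))}"
      using n by (auto simp: complex_eq_iff)
  next
    assume "w \<in> {Complex (a * ln y) (pi * a), Complex (a * ln y) (- (pi * a))}"
    then show "\<exists>n::int. Re w = a * ln y \<and> Im w = a * pi * (2 * n + 1)"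
      by (auto intro: exI[of _ 0] exI[of _ "-1"])
  qed
  finally show ?thesis .
qed

section \<open>The quadrature sum and the integral as contour integrals\<close>

lemma holomorphic_phase: "a \<noteq> 0 \<Longrightarrow> phase a holomorphic_on A"
  unfolding phase_def by (intro holomorphic_intros) auto

lemma phase_has_derivative:
  assumes "a \<noteq> 0"
  shows "(phase a has_field_derivative - (\<i> * w / (pi * a)) * phase a w) (at w)"
  unfolding phase_def using assms
  by (auto intro!: derivative_eq_intros simp: field_simps)

lemma holomorphic_stieltjes_kernel:
  assumes "a \<noteq> 0" "\<And>w. w \<in> A \<Longrightarrow> complex_of_real y + exp (w / a) \<noteq> 0"
  shows "stieltjes_kernel a y holomorphic_on A"
  unfolding stieltjes_kernel_def using assms by (intro holomorphic_intros) auto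

lemma residue_stieltjes_kernel:
  assumes a: "a > 0" and y: "y > 0" and T: "open T" "connected T" "p \<in> T"
    and G: "G holomorphic_on T" "G p \<noteq> 0"
    and p: "complex_of_real y + exp (p / a) = 0"
  shows "residue (\<lambda>w. stieltjes_kernel a y w * G w) p = - complex_of_real a * exp p * G p"
proof -
  have "residue (\<lambda>w. (exp w * y * G w) / (y + exp (w / a))) p = (exp p * y * G p) / (exp (p / a) / a)"
  proof (rule residue_simple_pole_deriv[OF _ _ T])
    show "((\<lambda>w. complex_of_real y + exp (w / complex_of_real a)) has_field_derivative exp (p / a) / a) (at p)"
      using a by (auto intro!: derivative_eq_intros)
  qed (use a y G p in \<open>auto intro!: holomorphic_intros\<close>)
  moreover have "exp (p / a) = - complex_of_real y" using p by (simp add: add_eq_0_iff)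
  ultimately show ?thesis using a y by (simp add: stieltjes_kernel_def field_simps)
qed

text \<open>Multiplied by \<open>2 \<pi> \<i>\<close>, this is the kernel at the node times the local step \<open>2 \<pi>\<^sup>2 a / node a j\<close>, the
  derivative of \<open>node a\<close> at \<open>j\<close>.\<close>

lemma residue_node:
  assumes a: "a > 0" and y: "y > 0" and j: "j \<ge> (1::nat)"
  shows "residue (\<lambda>w. stieltjes_kernel a y w * (1 / (1 - phase a w))) (node a (real j)) = stieltjes_kernel a y (node a (real j)) * (pi * a) / (\<i> * node a j)"
proof -
  let ?R = "node a (real j + 1)"
  let ?T = "box (Complex 0 (- (pi * a))) (Complex ?R (pi * a))"
  have n: "node a j > 0" using a j by (intro node_pos) auto
  have nz: "complex_of_real y + exp (w / a) \<noteq> 0" if "w \<in> ?T" for w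
    using stieltjes_kernel_pole_iff[OF a y, of w] that a by (auto simp: in_box_complex_iff abs_less_iff)
  have ph: "phase a (node a (real j)) = 1" using phase_eq_1_iff[OF a, of "node a j"] n j by auto
  have "residue (\<lambda>w. stieltjes_kernel a y w / (1 - phase a w)) (node a (real j)) = stieltjes_kernel a y (node a (real j)) / (\<i> * node a j / (pi * a))"
  proof (rule residue_simple_pole_deriv[where s = ?T])
    show "stieltjes_kernel a y holomorphic_on ?T" using a nz by (intro holomorphic_stieltjes_kernel) auto
    show "(\<lambda>w. 1 - phase a w) holomorphic_on ?T" using a by (intro holomorphic_intros holomorphic_phase) auto
    show "connected ?T" by (intro convex_connected convex_box)
    show in_T: "complex_of_real (node a (real j)) \<in> ?T" using a n node_mono[OF a, of "real j" "real j + 1"] by (auto simp: in_box_complex_iff)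
    show "stieltjes_kernel a y (node a (real j)) \<noteq> 0" using nz[OF in_T] y by (auto simp: stieltjes_kernel_def)
    show "((\<lambda>w. 1 - phase a w) has_field_derivative \<i> * node a j / (pi * a)) (at (node a (real j)))"
      using a ph by (auto intro!: derivative_eq_intros phase_has_derivative)
  qed (use a n ph in auto)
  then show ?thesis by simp
qed

text \<open>The vertical edges run half-way between nodes, and the rectangle extends beyond the two poles
  \<open>a ln y \<plusminus> \<i> \<pi> a\<close> of the kernel; these lie inside precisely if \<open>p0 < a ln y\<close>.\<close>

lemma weighted_node_sum_contour:
  assumes a: "a > 0" and y: "y > 0" and JM: "J < M"
    and p0: "p0 = node a (real J + 1/2)" and p1: "p1 = node a (real M + 1/2)"
    and yp: "a * ln y < p1" "a * ln y \<noteq> p0"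
  defines "\<Phi> \<equiv> \<lambda>w. 1 / (1 - phase a w)"
  defines "F \<equiv> \<lambda>p q. stieltjes_kernel a y (Complex p q) * \<Phi> (Complex p q)"
  defines "h \<equiv> 2 * pi * a"
  defines "wp \<equiv> Complex (a * ln y) (pi * a)" and "wm \<equiv> Complex (a * ln y) (- (pi * a))"
  shows "(\<Sum>j=J+1..M. complex_of_real (2 * pi\<^sup>2 * a / node a (real j)) * stieltjes_kernel a y (node a (real j)))
     = integral {p0..p1} (\<lambda>p. F p (- h)) + \<i> * integral {-h..h} (F p1)
       - integral {p0..p1} (\<lambda>p. F p h) - \<i> * integral {-h..h} (F p0)
       + (if p0 < a * ln y then 2 * pi * \<i> * a * (exp wp * \<Phi> wp + exp wm * \<Phi> wm) else 0)"
proof -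
  let ?R = "node a (real M + 1)"
  let ?S = "box (Complex 0 (- (3 * pi * a))) (Complex ?R (3 * pi * a))"
  let ?N = "(\<lambda>j::nat. complex_of_real (node a (real j))) ` {1..M}"
  let ?pts = "?N \<union> {wp, wm}"
  let ?B = "box (Complex p0 (-h)) (Complex p1 h)"
  let ?CB = "cbox (Complex p0 (-h)) (Complex p1 h)"
  let ?f = "\<lambda>w. stieltjes_kernel a y w * \<Phi> w"
  have h: "h > 0" using a by (simp add: h_def)
  have p0p: "p0 > 0" unfolding p0 using a by (intro node_pos) auto
  have p01: "p0 < p1" unfolding p0 p1 using a JM by (intro node_mono) auto
  have p1R: "p1 < ?R" unfolding p1 using a by (intro node_mono) auto
  have mono: "node a u < node a v \<longleftrightarrow> u < v" for u v
    using a by (auto simp: node_def)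
  have nz: "complex_of_real y + exp (w / a) = 0 \<longleftrightarrow> w \<in> {wp, wm}" if "\<bar>Im w\<bar> < 3 * pi * a" for w
    unfolding wp_def wm_def using stieltjes_kernel_pole_iff[OF a y] that by simp
  have ph: "1 - phase a w = 0 \<longleftrightarrow> w \<in> ?N" if "w \<in> ?S" for w
  proof -
    have "1 - phase a w = 0 \<longleftrightarrow> phase a w = 1" by auto
    also have "\<dots> \<longleftrightarrow> (\<exists>j::nat. j \<ge> 1 \<and> w = node a j)"
      using that by (intro phase_eq_1_iff a) (auto simp: in_box_complex_iff)
    also have "\<dots> \<longleftrightarrow> w \<in> ?N"
    proof
      assume "\<exists>j::nat. j \<ge> 1 \<and> w = node a j"
      then obtain j :: nat where j: "j \<ge> 1" "w = node a j" by auto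
      then have "node a j < node a (real M + 1)" using that by (auto simp: in_box_complex_iff)
      then show "w \<in> ?N" using j unfolding mono by auto
    qed auto
    finally show ?thesis .
  qed
  have avoid: "p \<in> ?B" if "p \<in> ?pts" "p \<in> ?CB" for p
  proof -
    consider j :: nat where "j \<in> {1..M}" "p = node a j" | "p \<in> {wp, wm}" using \<open>p \<in> ?pts\<close> by auto
    then show ?thesis
    proof cases
      case 1
      then have "p0 \<le> node a j" "node a j \<le> p1" using that(2) by (auto simp: in_cbox_complex_iff)
      then have "\<not> real j < real J + 1/2" "\<not> real j > real M + 1/2" unfolding p0 p1 
        using mono by (meson leD)+
      then have "real (2 * J + 1) \<le> real (2 * j)" "real (2 * j) \<le> real (2 * M + 1)" by simp_all
      then have "2 * J + 1 \<le> 2 * j" "2 * j \<le> 2 * M + 1" by (simp_all only: of_nat_le_iff)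
      then have "J < j" "j \<le> M" by arith+
      then have "real J + 1/2 < real j" "real j < real M + 1/2" by linarith+
      then show ?thesis using 1 h unfolding p0 p1 by (auto simp: in_box_complex_iff mono)
    next
      case 2
      then show ?thesis using that(2) yp h a unfolding wp_def wm_def
        by (auto simp: in_box_complex_iff in_cbox_complex_iff h_def)
    qed
  qed
  have inter: "?pts \<inter> ?B = (\<lambda>j::nat. complex_of_real (node a (real j))) ` {J+1..M} \<union> (if p0 < a * ln y then {wp, wm} else {})"
  proof -
    have "complex_of_real (node a (real j)) \<in> ?B \<longleftrightarrow> j \<in> {J+1..M}" for j :: nat
    proof -
      have "complex_of_real (node a (real j)) \<in> ?B \<longleftrightarrow> real J + 1/2 < real j \<and> real j < real M + 1/2"
        unfolding p0 p1 using h by (simp add: in_box_complex_iff mono)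
      also have "\<dots> \<longleftrightarrow> j \<in> {J+1..M}" by auto
      finally show ?thesis .
    qed
    moreover have "{J+1..M} \<subseteq> {1..M}" by auto
    ultimately have "?N \<inter> ?B = (\<lambda>j::nat. complex_of_real (node a (real j))) ` {J+1..M}" by blast
    moreover have "wp \<in> ?B \<longleftrightarrow> p0 < a * ln y" "wm \<in> ?B \<longleftrightarrow> p0 < a * ln y"
      using a yp by (simp_all add: in_box_complex_iff wp_def wm_def h_def)
    then have "{wp, wm} \<inter> ?B = (if p0 < a * ln y then {wp, wm} else {})" by simp
    ultimately show ?thesis by (simp only: Int_Un_distrib2)
  qed
  have res_p: "residue ?f w = - complex_of_real a * exp w * \<Phi> w" if "w \<in> {wp, wm}" "p0 < a * ln y" for w :: complex
  proof -
    let ?T = "if w = wp then box (Complex 0 0) (Complex ?R (3 * pi * a)) else box (Complex 0 (- (3 * pi * a))) (Complex ?R 0)"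
    have ap: "pi * a > 0" using a by simp
    have T: "?T \<subseteq> ?S" "w \<in> ?T" "?T \<inter> ?N = {}"
      using that yp p1R p0p a ap by (auto simp: in_box_complex_iff wp_def wm_def)
    then have nzT: "1 - phase a v \<noteq> 0" if "v \<in> ?T" for v using that ph by blast
    show ?thesis
    proof (rule residue_stieltjes_kernel[OF a y, where T = ?T])
      show "\<Phi> holomorphic_on ?T" unfolding \<Phi>_def using a nzT by (intro holomorphic_intros holomorphic_phase) auto
      show "\<Phi> w \<noteq> 0" unfolding \<Phi>_def using nzT T by auto
      show "complex_of_real y + exp (w / a) = 0" using nz[of w] that a by (auto simp: wp_def wm_def)
    qed (use T(2) in \<open>auto intro!: convex_connected convex_box\<close>)
  qed
  have wpm: "wp \<noteq> wm" "wp \<notin> range complex_of_real" "wm \<notin> range complex_of_real" 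
    using a by (auto simp: wp_def wm_def complex_eq_iff)
  have "integral {p0..p1} (\<lambda>p. F p (- h)) + \<i> * integral {-h..h} (F p1)
       - integral {p0..p1} (\<lambda>p. F p h) - \<i> * integral {-h..h} (F p0)
     = 2 * pi * \<i> * (\<Sum>p\<in>?pts \<inter> ?B. residue ?f p)"
    unfolding F_def
  proof (rule rectangle_residue_theorem[where S = ?S and f = ?f])
    show "?CB \<subseteq> ?S"
    proof
      fix w assume "w \<in> ?CB"
      moreover have "pi * a > 0" using a by simp
      ultimately show "w \<in> ?S" using p0p p1R
        unfolding in_box_complex_iff in_cbox_complex_iff h_def complex.sel atLeastAtMost_iff greaterThanLessThan_iff by linarith
    qed
    show "?f holomorphic_on ?S - ?pts" unfolding \<Phi>_def
      using a nz ph by (intro holomorphic_intros holomorphic_phase holomorphic_stieltjes_kernel) (auto simp: in_box_complex_iff abs_less_iff)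
  qed (use p01 h avoid in \<open>auto intro!: convex_connected convex_box\<close>)
  also have "(\<Sum>p\<in>?pts \<inter> ?B. residue ?f p) = 
      (\<Sum>p\<in>(\<lambda>j::nat. complex_of_real (node a (real j))) ` {J+1..M}. residue ?f p)
      + (\<Sum>p\<in>(if p0 < a * ln y then {wp, wm} else {}). residue ?f p)"
    unfolding inter using wpm by (intro sum.union_disjoint) auto
  also have "(\<Sum>p\<in>(if p0 < a * ln y then {wp, wm} else {}). residue ?f p)
     = (if p0 < a * ln y then - complex_of_real a * (exp wp * \<Phi> wp + exp wm * \<Phi> wm) else 0)"
    using wpm(1) res_p by (auto simp: algebra_simps)
  also have "(\<Sum>p\<in>(\<lambda>j::nat. complex_of_real (node a (real j))) ` {J+1..M}. residue ?f p)
      = (\<Sum>j=J+1..M. residue ?f (node a (real j)))"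
    by (subst sum.reindex) (auto simp: inj_on_def node_def a less_imp_neq[OF a, symmetric] less_imp_le[OF a])
  also have "\<dots> = (\<Sum>j=J+1..M. stieltjes_kernel a y (node a (real j)) * (pi * a) / (\<i> * node a j))"
    unfolding \<Phi>_def using a y by (intro sum.cong residue_node) auto
  also have "2 * pi * \<i> * ((\<Sum>j=J+1..M. stieltjes_kernel a y (node a (real j)) * (pi * a) / (\<i> * node a j)) + 
       (if p0 < a * ln y then - complex_of_real a * (exp wp * \<Phi> wp + exp wm * \<Phi> wm) else 0))
     = (\<Sum>j=J+1..M. complex_of_real (2 * pi\<^sup>2 * a / node a (real j)) * stieltjes_kernel a y (node a (real j)))
       - (if p0 < a * ln y then 2 * pi * \<i> * a * (exp wp * \<Phi> wp + exp wm * \<Phi> wm) else 0)"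
    by (auto simp: algebra_simps sum_distrib_left power2_eq_square intro!: sum.cong)
  finally show ?thesis by (simp add: algebra_simps)
qed

text \<open>The bottom edge carries the same integrand as the real axis up to the factor \<open>exp (- 2 \<pi> \<i> a)\<close>
  (lemma \<open>stieltjes_kernel_shift\<close>), so for non-integral \<open>a\<close> this equation evaluates the integral over
  the bottom edge in terms of the residue \<open>y\<^sup>a\<close> and the vertical edges.\<close>

lemma kernel_integral_contour:
  assumes a: "a > 0" and y: "y > 0" 
    and p01: "p0 < p1" and yp: "a * ln y < p1" "a * ln y \<noteq> p0"
  defines "h \<equiv> 2 * pi * a"
  defines "wm \<equiv> Complex (a * ln y) (- (pi * a))"
  shows "integral {p0..p1} (\<lambda>p. stieltjes_kernel a y (Complex p (- h))) + \<i> * integral {-h..0} (\<lambda>q. stieltjes_kernel a y (Complex p1 q))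
       - integral {p0..p1} (\<lambda>p. stieltjes_kernel a y (Complex p 0)) - \<i> * integral {-h..0} (\<lambda>q. stieltjes_kernel a y (Complex p0 q))
       = (if p0 < a * ln y then - (2 * pi * \<i> * a * exp wm) else 0)"
proof -
  let ?wp = "Complex (a * ln y) (pi * a)"
  let ?S = "box (Complex (p0 - 1) (- (3 * pi * a))) (Complex (p1 + 1) (3 * pi * a))"
  let ?B = "box (Complex p0 (-h)) (Complex p1 0)"
  have nz: "complex_of_real y + exp (w / a) = 0 \<longleftrightarrow> w \<in> {?wp, wm}" if "\<bar>Im w\<bar> < 3 * pi * a" for w
    unfolding wm_def using stieltjes_kernel_pole_iff[OF a y] that by simp
  have ap: "pi * a > 0" using a by simp
  have "integral {p0..p1} (\<lambda>p. stieltjes_kernel a y (Complex p (- h))) + \<i> * integral {-h..0} (\<lambda>q. stieltjes_kernel a y (Complex p1 q))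
       - integral {p0..p1} (\<lambda>p. stieltjes_kernel a y (Complex p 0)) - \<i> * integral {-h..0} (\<lambda>q. stieltjes_kernel a y (Complex p0 q))
       = 2 * pi * \<i> * (\<Sum>p\<in>{?wp, wm} \<inter> ?B. residue (stieltjes_kernel a y) p)"
  proof (rule rectangle_residue_theorem[where S = ?S])
    show "stieltjes_kernel a y holomorphic_on ?S - {?wp, wm}"
      using a nz by (intro holomorphic_stieltjes_kernel) (auto simp: in_box_complex_iff abs_less_iff)
    show "cbox (Complex p0 (- h)) (Complex p1 0) \<subseteq> ?S"
    proof
      fix w assume "w \<in> cbox (Complex p0 (- h)) (Complex p1 0)"
      then show "w \<in> ?S" using ap unfolding in_box_complex_iff in_cbox_complex_iff h_def complex.sel atLeastAtMost_iff greaterThanLessThan_iff by linarith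
    qed
    show "w \<in> ?B" if "w \<in> {?wp, wm}" "w \<in> cbox (Complex p0 (- h)) (Complex p1 0)" for w
      using that ap yp a pi_gt_zero unfolding in_box_complex_iff in_cbox_complex_iff h_def wm_def
      by (elim insertE) (auto simp: mult_le_0_iff)
    show "- h < 0" using ap by (simp add: h_def)
  qed (use p01 in \<open>auto intro!: convex_connected convex_box\<close>)
  also have "{?wp, wm} \<inter> ?B = (if p0 < a * ln y then {wm} else {})"
    using a yp by (auto simp: in_box_complex_iff h_def wm_def mult_less_0_iff)
  also have "residue (stieltjes_kernel a y) wm = - complex_of_real a * exp wm"
    using residue_stieltjes_kernel[OF a y, of UNIV wm "\<lambda>_. 1"] nz[of wm] a by (auto simp: wm_def)
  then have "2 * pi * \<i> * (\<Sum>p\<in>(if p0 < a * ln y then {wm} else {}). residue (stieltjes_kernel a y) p)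
     = (if p0 < a * ln y then - (2 * pi * \<i> * a * exp wm) else 0)" by simp
  finally show ?thesis .
qed

section \<open>Boundedness of the quadrature error\<close>

text \<open>The denominator can vanish only for \<open>\<bar>exp (w / a)\<bar> = y\<close>, that is \<open>Re w = a ln y\<close>.\<close>

lemma norm_stieltjes_kernel_le:
  assumes a: "a > 0" and y: "y > 0" and d: "\<delta> > 0" "\<bar>a * ln y - Re w\<bar> \<ge> \<delta>"
  shows "norm (stieltjes_kernel a y w) \<le> exp (Re w) / (1 - exp (- \<delta> / a))"
proof -
  let ?s = "exp (Re w / a)" and ?e = "exp (- \<delta> / a)"
  have e1: "?e < 1" using a d by (simp add: divide_neg_pos)
  have ns: "norm (exp (w / a)) = ?s" by simp
  have "norm (complex_of_real y + exp (w / a)) \<ge> y * (1 - ?e)"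
  proof (cases "Re w \<le> a * ln y - \<delta>")
    case True
    then have "Re w / a \<le> ln y + - \<delta> / a" using a by (simp add: field_simps)
    then have "?s \<le> exp (ln y + - \<delta> / a)" by simp
    also have "\<dots> = y * ?e" using y by (simp only: exp_add exp_ln)
    finally have "y * (1 - ?e) \<le> norm (complex_of_real y) - norm (exp (w / a))"
      using y by (simp add: ns algebra_simps)
    then show ?thesis using norm_diff_ineq order_trans by blast
  next
    case False
    then have "ln y \<le> Re w / a + - \<delta> / a" using a d by (simp add: field_simps abs_if split: if_splits)
    then have "exp (ln y) \<le> exp (Re w / a + - \<delta> / a)" by (simp only: exp_le_cancel_iff)
    then have ys: "y \<le> ?s * ?e" using y by (simp only: exp_add exp_ln)
    also have "\<dots> \<le> ?s * 1" using e1 by (intro mult_left_mono) auto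
    finally have "y \<le> ?s" by simp
    then have "y * (1 - ?e) \<le> ?s * (1 - ?e)" using e1 by (intro mult_right_mono) auto
    also have "\<dots> \<le> norm (exp (w / a)) - norm (complex_of_real y)"
      using y ys by (simp add: ns algebra_simps)
    also have "\<dots> \<le> norm (exp (w / a) + complex_of_real y)" by (rule norm_diff_ineq)
    finally show ?thesis by (simp add: add.commute)
  qed
  then have "norm (stieltjes_kernel a y w) \<le> exp (Re w) * y / (y * (1 - ?e))"
    unfolding stieltjes_kernel_def norm_divide norm_mult using y e1
    by (intro frac_le mult_nonneg_nonneg mult_pos_pos) auto
  then show ?thesis using y by simp
qed

lemma exp_shift_period:
  assumes "a \<noteq> 0"
  shows "exp (Complex p (2 * pi * a) / a) = exp (p / a)" "exp (Complex p (- (2 * pi * a)) / a) = exp (p / a)"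
proof -
  have 1: "Complex p (2 * pi * a) / a = complex_of_real (p / a) + \<i> * (of_int 1 * (of_real pi * 2))"
    using assms by (simp add: complex_eq_iff)
  have 2: "Complex p (- (2 * pi * a)) / a = complex_of_real (p / a) + \<i> * (of_int (-1) * (of_real pi * 2))"
    using assms by (simp add: complex_eq_iff)
  show "exp (Complex p (2 * pi * a) / a) = exp (p / a)" unfolding 1 by (simp only: exp_plus_2pin exp_of_real)
  show "exp (Complex p (- (2 * pi * a)) / a) = exp (p / a)" unfolding 2 by (simp only: exp_plus_2pin exp_of_real)
qed

lemma norm_stieltjes_kernel_horizontal:
  assumes a: "a > 0" and y: "y > 0" and q: "q \<in> {2 * pi * a, - (2 * pi * a)}"
  shows "norm (stieltjes_kernel a y (Complex p q)) \<le> exp p"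
    "complex_of_real y + exp (Complex p q / a) \<noteq> 0"
proof -
  have e: "exp (Complex p q / a) = complex_of_real (exp (p / a))"
    using q a exp_shift_period[of a p] by auto
  have s: "complex_of_real y + exp (Complex p q / a) = complex_of_real (y + exp (p / a))" by (simp add: e)
  have pos: "y + exp (p / a) > 0" using y by (simp add: add_pos_pos)
  then show "complex_of_real y + exp (Complex p q / a) \<noteq> 0" unfolding s by (simp only: of_real_eq_0_iff) 
  have "norm (stieltjes_kernel a y (Complex p q)) = exp p * (y / (y + exp (p / a)))"
    unfolding stieltjes_kernel_def s norm_divide norm_mult norm_of_real using pos y by simp
  also have "\<dots> \<le> exp p * 1" using y pos by (intro mult_left_mono) auto
  finally show "norm (stieltjes_kernel a y (Complex p q)) \<le> exp p" by simp
qed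

lemma stieltjes_kernel_shift:
  assumes "a > 0"
  shows "stieltjes_kernel a y (Complex p (- (2 * pi * a))) = exp (- (2 * pi * \<i> * a)) * stieltjes_kernel a y (Complex p 0)"
proof -
  have "exp (Complex p (- (2 * pi * a))) = exp (- (2 * pi * \<i> * a)) * exp (Complex p 0)"
    unfolding exp_add[symmetric] by (rule arg_cong[where f = exp]) (simp add: complex_eq_iff)
  moreover have "exp (Complex p 0 / a) = exp (p / a)"
    unfolding exp_of_real[symmetric] by (rule arg_cong[where f = exp]) (simp add: complex_eq_iff)
  ultimately show ?thesis using assms by (simp add: stieltjes_kernel_def exp_shift_period)
qed

lemma continuous_on_stieltjes_kernel:
  assumes "a \<noteq> 0" "continuous_on A g" "\<And>x. x \<in> A \<Longrightarrow> complex_of_real y + exp (g x / a) \<noteq> 0"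
  shows "continuous_on A (\<lambda>x. stieltjes_kernel a y (g x))"
  unfolding stieltjes_kernel_def using assms by (intro continuous_intros) auto

lemma continuous_on_phase:
  assumes "a \<noteq> 0" "continuous_on A g"
  shows "continuous_on A (\<lambda>x. phase a (g x))"
  unfolding phase_def using assms by (intro continuous_intros) auto

lemma norm_integral_exp_decay:
  fixes f :: "real \<Rightarrow> complex"
  assumes "continuous_on {u..v} f" "u \<le> v" "u \<ge> 0" "B \<ge> 0" "\<And>p. p \<in> {u..v} \<Longrightarrow> norm (f p) \<le> B * exp (- p)"
  shows "norm (integral {u..v} f) \<le> B"
proof -
  have I: "((\<lambda>p. B * exp (- p)) has_integral (- B * exp (- v) - (- B * exp (- u)))) {u..v}"
    using assms(2)
    by (intro fundamental_theorem_of_calculus)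
       (auto intro!: derivative_eq_intros simp: has_real_derivative_iff_has_vector_derivative[symmetric])
  have "norm (integral {u..v} f) \<le> integral {u..v} (\<lambda>p. B * exp (- p))"
    using assms I by (intro integral_norm_bound_integral) (auto intro: integrable_continuous_real has_integral_integrable)
  also have "\<dots> = B * (exp (- u) - exp (- v))" unfolding integral_unique[OF I] by (simp add: algebra_simps)
  also have "\<dots> \<le> B * 1" using assms by (intro mult_left_mono) (auto intro: order_trans[of _ "exp (- u)"])
  finally show ?thesis by simp
qed

text \<open>Far above the real axis \<open>1 / (1 - z)\<close> is close to 0 for \<open>z = phase a w\<close>, far below it is close to 1. So
  the quadrature sum and the integral differ on either side only by an exponentially small integrand.\<close>

lemma norm_trapezoid_factor_le:
  fixes z :: complex
  assumes n: "norm z = exp x"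
  shows "x > 0 \<Longrightarrow> norm (1 / (1 - z)) \<le> exp (- x) / (1 - exp (- x))"
    "x < 0 \<Longrightarrow> norm (1 / (1 - z) - 1) \<le> exp x / (1 - exp x)"
proof -
  {
    assume "x > 0"
    then have pos: "exp x - 1 > 0" by simp
    have "norm (1 - z) \<ge> exp x - 1" using n norm_triangle_ineq2[of "z" 1] by (simp add: norm_minus_commute)
    then have "norm (1 / (1 - z)) \<le> 1 / (exp x - 1)"
      using pos unfolding norm_divide norm_one by (intro frac_le) auto
    also have "\<dots> = exp (- x) / (1 - exp (- x))" by (simp add: exp_minus field_simps)
    finally show "norm (1 / (1 - z)) \<le> exp (- x) / (1 - exp (- x))" .
  }
  {
    assume "x < 0"
    then have pos: "1 - exp x > 0" by simp
    have le: "norm (1 - z) \<ge> 1 - exp x" using n norm_triangle_ineq2[of 1 "z"] by simp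
    then have "1 - z \<noteq> 0" using pos by auto
    then have "1 / (1 - z) - 1 = z / (1 - z)" by (simp add: field_simps)
    then show "norm (1 / (1 - z) - 1) \<le> exp x / (1 - exp x)"
      using le pos n by (simp add: norm_divide frac_le)
  }
qed

text \<open>What the right edges of the two rectangles contribute; the factor of the second integral comes from
  solving \<open>kernel_integral_contour\<close> for the bottom edge.\<close>

definition right_edge :: "real \<Rightarrow> nat \<Rightarrow> real \<Rightarrow> complex" where
  "right_edge a M y =
     integral {- (2 * pi * a)..2 * pi * a} (\<lambda>q. stieltjes_kernel a y (Complex (node a (real M + 1/2)) q)
       * (1 / (1 - phase a (Complex (node a (real M + 1/2)) q))))
     - 1 / (1 - exp (2 * pi * \<i> * a)) *
       integral {- (2 * pi * a)..0} (\<lambda>q. stieltjes_kernel a y (Complex (node a (real M + 1/2)) q))"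

text \<open>The constant depends neither on the number of nodes nor on \<open>y\<close>, as long as the pole abscissa \<open>a ln y\<close>
  keeps the distance \<open>\<delta>\<close> from the left edge. The exclusion is harmless: the first \<open>J\<close> terms of the sum are bounded,
  so \<open>J\<close> may be chosen depending on \<open>y\<close>.\<close>

lemma trapezoid_error:
  assumes a: "a > 0" and sin: "sin (pi * a) \<noteq> 0" and d: "\<delta> > 0"
  shows "\<exists>C. \<forall>M y. J < M \<longrightarrow> y > 0 \<longrightarrow> a * ln y < node a (real M + 1/2) \<longrightarrow>
      \<bar>a * ln y - node a (real J + 1/2)\<bar> \<ge> \<delta> \<longrightarrow>
    norm ((\<Sum>j=J+1..M. complex_of_real (2 * pi\<^sup>2 * a / node a (real j)) * stieltjes_kernel a y (node a (real j)))
      - pi * a / sin (pi * a) * y powr a - \<i> * right_edge a M y) \<le> C"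
proof -
  define p0 where "p0 = node a (real J + 1/2)"
  define h where "h = 2 * pi * a"
  define \<mu> where "\<mu> = 1 / (1 - exp (2 * pi * \<i> * a))"
  define \<kappa> where "\<kappa> = pi * a / sin (pi * a)"
  define K where "K = exp p0 / (1 - exp (- \<delta> / a))"
  define C1 where "C1 = 1 / (1 - exp (- 2 * p0))"
  define C2 where "C2 = 1 / (1 - exp (- p0))"
  define \<Phi> where "\<Phi> = (\<lambda>w. 1 / (1 - phase a w))"
  define C where "C = norm \<mu> * (K * h) + C1 + C1 + 2 * K * (2 * h) + 2 * pi * a * (C2 + C2) + \<bar>\<kappa>\<bar> * exp p0"
  have h: "h > 0" using a by (simp add: h_def)
  have p0: "p0 > 0" unfolding p0_def using a by (intro node_pos) auto
  have K: "K > 0" unfolding K_def using a d by (simp add: divide_neg_pos)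
  have C1: "C1 > 0" and C2: "C2 > 0" unfolding C1_def C2_def using p0 by auto
  have main: "norm ((\<Sum>j=J+1..M. complex_of_real (2 * pi\<^sup>2 * a / node a (real j)) * stieltjes_kernel a y (node a (real j)))
      - \<kappa> * y powr a
      - \<i> * (integral {- h..h} (\<lambda>q. stieltjes_kernel a y (Complex p1 q) * \<Phi> (Complex p1 q))
           - \<mu> * integral {- h..0} (\<lambda>q. stieltjes_kernel a y (Complex p1 q)))) \<le> C"
    if JM: "J < M" and y: "y > 0" and p1: "p1 = node a (real M + 1/2)" and yp1: "a * ln y < p1"
      and yp0: "\<bar>a * ln y - p0\<bar> \<ge> \<delta>" for M y p1
  proof -
    have p01: "p0 < p1" unfolding p0_def p1 using a JM by (intro node_mono) auto
    have yne: "a * ln y \<noteq> p0" using yp0 d by auto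
    define x where "x = a * ln y"
    define wp wm where "wp = Complex x (pi * a)" and "wm = Complex x (- (pi * a))"
    \<comment> \<open>The residues count only if the poles of the kernel lie inside the contour.\<close>
    define ind :: complex where "ind = (if p0 < x then 1 else 0)"
    define \<Sigma> where "\<Sigma> = (\<Sum>j=J+1..M. complex_of_real (2 * pi\<^sup>2 * a / node a (real j)) * stieltjes_kernel a y (node a (real j)))"
    define R Rb where "R = integral {- h..h} (\<lambda>q. stieltjes_kernel a y (Complex p1 q) * \<Phi> (Complex p1 q))"
      and "Rb = integral {- h..0} (\<lambda>q. stieltjes_kernel a y (Complex p1 q))"
    define L Lb where "L = integral {- h..h} (\<lambda>q. stieltjes_kernel a y (Complex p0 q) * \<Phi> (Complex p0 q))"
      and "Lb = integral {- h..0} (\<lambda>q. stieltjes_kernel a y (Complex p0 q))"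
    define tp bt b0 I bs where "tp = integral {p0..p1} (\<lambda>p. stieltjes_kernel a y (Complex p h) * \<Phi> (Complex p h))"
      and "bt = integral {p0..p1} (\<lambda>p. stieltjes_kernel a y (Complex p (- h)) * \<Phi> (Complex p (- h)))"
      and "b0 = integral {p0..p1} (\<lambda>p. stieltjes_kernel a y (Complex p (- h)))"
      and "I = integral {p0..p1} (\<lambda>p. stieltjes_kernel a y (Complex p 0))"
      and "bs = integral {p0..p1} (\<lambda>p. stieltjes_kernel a y (Complex p (- h)) * (\<Phi> (Complex p (- h)) - 1))"
    have A: "\<Sigma> = bt + \<i> * R - tp - \<i> * L + ind * (2 * pi * \<i> * a * (exp wp * \<Phi> wp + exp wm * \<Phi> wm))"
      using weighted_node_sum_contour[OF a y JM p0_def p1 yp1 yne]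
      unfolding \<Sigma>_def bt_def R_def tp_def L_def ind_def wp_def wm_def x_def \<Phi>_def h_def by (simp split: if_splits)
    have B: "b0 + \<i> * Rb - I - \<i> * Lb = - ind * (2 * pi * \<i> * a * exp wm)"
      using kernel_integral_contour[OF a y p01 yp1 yne]
      unfolding b0_def Rb_def I_def Lb_def ind_def wm_def x_def h_def by (simp split: if_splits)
    have "b0 = exp (- (2 * pi * \<i> * a)) * I"
      unfolding b0_def I_def h_def stieltjes_kernel_shift[OF a] by simp
    then have Ib0: "I = exp (2 * pi * \<i> * a) * b0" by (simp add: exp_minus)
    have E1: "exp (2 * pi * \<i> * a) = exp (\<i> * (pi * a)) * exp (\<i> * (pi * a))"
      by (simp add: exp_add[symmetric] algebra_simps)
    have E2: "1 - exp (2 * pi * \<i> * a) = - (2 * \<i> * sin (pi * a)) * exp (\<i> * (pi * a))"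
    proof -
      have s: "2 * \<i> * complex_of_real (sin (pi * a)) = exp (\<i> * (pi * a)) - exp (- (\<i> * (pi * a)))"
        by (simp add: sin_of_real[symmetric] sin_exp_eq del: sin_of_real)
      have i: "exp (- (\<i> * (pi * a))) * exp (\<i> * (pi * a)) = 1"
        by (simp add: exp_add[symmetric])
      show ?thesis unfolding s E1 minus_mult_left[symmetric] left_diff_distrib i by simp
    qed
    have ne: "1 - exp (2 * pi * \<i> * a) \<noteq> 0" unfolding E2 using sin by simp
    have b0: "b0 = \<mu> * (- ind * (2 * pi * \<i> * a * exp wm) - \<i> * Rb + \<i> * Lb)"
      using B ne unfolding Ib0 \<mu>_def by (simp add: field_simps)
    have ya: "complex_of_real (y powr a) = complex_of_real (exp x)" using y by (simp add: x_def powr_def mult.commute)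
    have wm: "exp wm = exp x * exp (- (\<i> * (pi * a)))"
      unfolding exp_of_real[symmetric] exp_add[symmetric] by (rule arg_cong[where f = exp]) (simp add: wm_def complex_eq_iff)
    \<comment> \<open>The residue of the lower pole, from both contours together, is the main term.\<close>
    have res_main: "2 * pi * \<i> * a * exp wm * (1 - \<mu>) = \<kappa> * y powr a"
    proof -
      define e e' S where "e = exp (\<i> * complex_of_real (pi * a))" and "e' = exp (- (\<i> * complex_of_real (pi * a)))"
        and "S = complex_of_real (sin (pi * a))"
      have nz: "e \<noteq> 0" "S \<noteq> 0" and ee: "e' * e = 1"
        using sin by (simp_all add: e_def e'_def S_def exp_add[symmetric])
      have "1 - \<mu> = - (e * e) / (1 - exp (2 * pi * \<i> * a))"
        unfolding \<mu>_def e_def E1[symmetric] using ne by (simp add: field_simps)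
      also have "\<dots> = e / (2 * \<i> * S)"
        unfolding E2 S_def[symmetric] e_def[symmetric] using nz by (simp add: field_simps)
      finally have mu: "1 - \<mu> = e / (2 * \<i> * S)" .
      have "2 * pi * \<i> * a * exp wm * (1 - \<mu>) = pi * a / S * exp x * (e' * e)"
        unfolding mu wm e'_def[symmetric] using nz by (simp add: field_simps)
      then show ?thesis by (simp add: ee ya \<kappa>_def S_def)
    qed
    have cont_h: "continuous_on {p0..p1} (\<lambda>p. stieltjes_kernel a y (Complex p q))" if "q \<in> {h, - h}" for q
      using that a y norm_stieltjes_kernel_horizontal(2)[OF a y, of q]
      by (intro continuous_on_stieltjes_kernel continuous_on_Complex) (auto simp: h_def intro: continuous_intros)
    have xh: "Re (Complex p h) * Im (Complex p h) / (pi * a) = 2 * p"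
       "Re (Complex p (- h)) * Im (Complex p (- h)) / (pi * a) = - 2 * p" for p
      using a by (auto simp: h_def)
    have nph: "1 - phase a (Complex p q) \<noteq> 0" if "q \<in> {h, - h}" "p \<ge> p0" for p q
    proof
      assume "1 - phase a (Complex p q) = 0"
      then have "norm (phase a (Complex p q)) = 1" by simp
      then show False using that p0 xh[of p] by (auto simp: norm_phase)
    qed
    have cont_Phi: "continuous_on {p0..p1} (\<lambda>p. \<Phi> (Complex p q))" if "q \<in> {h, - h}" for q
      unfolding \<Phi>_def using that a nph
      by (intro continuous_intros continuous_on_phase) auto
    have bt: "bt = b0 + bs"
    proof -
      have "b0 + bs = integral {p0..p1} (\<lambda>p. stieltjes_kernel a y (Complex p (- h)) + stieltjes_kernel a y (Complex p (- h)) * (\<Phi> (Complex p (- h)) - 1))"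
        unfolding b0_def bs_def
        by (intro integral_add[symmetric] integrable_continuous_real continuous_intros cont_h cont_Phi) auto
      then show ?thesis unfolding bt_def by (simp add: algebra_simps)
    qed
    have decay: "exp p * (exp (- (2 * p)) / (1 - exp (- (2 * p)))) \<le> C1 * exp (- p)" if "p \<ge> p0" for p
    proof -
      have "exp p * (exp (- (2 * p)) / (1 - exp (- (2 * p)))) = exp (p + - (2 * p)) / (1 - exp (- (2 * p)))"
        by (simp only: exp_add times_divide_eq_right)
      also have "\<dots> = exp (- p) / (1 - exp (- (2 * p)))" by simp
      also have "\<dots> \<le> exp (- p) / (1 - exp (- 2 * p0))"
        using that p0 by (intro divide_left_mono mult_pos_pos) auto
      finally show ?thesis by (simp add: C1_def)
    qed
    have tp: "norm tp \<le> C1"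
      unfolding tp_def
    proof (rule norm_integral_exp_decay)
      fix p assume p: "p \<in> {p0..p1}"
      have "norm (stieltjes_kernel a y (Complex p h) * \<Phi> (Complex p h)) \<le> exp p * (exp (- (2 * p)) / (1 - exp (- (2 * p))))"
        unfolding norm_mult using p p0 norm_stieltjes_kernel_horizontal(1)[OF a y, of h p] 
          norm_trapezoid_factor_le(1)[of "phase a (Complex p h)" "2 * p"] xh(1)[of p]
        by (intro mult_mono) (auto simp: \<Phi>_def h_def norm_phase)
      also have "\<dots> \<le> C1 * exp (- p)" using decay p by simp
      finally show "norm (stieltjes_kernel a y (Complex p h) * \<Phi> (Complex p h)) \<le> C1 * exp (- p)" .
    qed (use p0 p01 C1 in \<open>auto intro!: continuous_intros cont_h cont_Phi\<close>)
    have bs: "norm bs \<le> C1"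
      unfolding bs_def
    proof (rule norm_integral_exp_decay)
      fix p assume p: "p \<in> {p0..p1}"
      have "norm (stieltjes_kernel a y (Complex p (- h)) * (\<Phi> (Complex p (- h)) - 1)) \<le> exp p * (exp (- (2 * p)) / (1 - exp (- (2 * p))))"
        unfolding norm_mult using p p0 norm_stieltjes_kernel_horizontal(1)[OF a y, of "- h" p] 
          norm_trapezoid_factor_le(2)[of "phase a (Complex p (- h))" "- 2 * p"] xh(2)[of p]
        by (intro mult_mono) (auto simp: \<Phi>_def h_def norm_phase)
      also have "\<dots> \<le> C1 * exp (- p)" using decay p by simp
      finally show "norm (stieltjes_kernel a y (Complex p (- h)) * (\<Phi> (Complex p (- h)) - 1)) \<le> C1 * exp (- p)" .
    qed (use p0 p01 C1 in \<open>auto intro!: continuous_intros cont_h cont_Phi\<close>)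
    have kL: "norm (stieltjes_kernel a y (Complex p0 q)) \<le> K" for q
      using norm_stieltjes_kernel_le[OF a y d, of "Complex p0 q"] yp0 by (simp add: K_def)
    have PhiL: "norm (\<Phi> (Complex p0 q)) \<le> 2" and PhiL0: "1 - phase a (Complex p0 q) \<noteq> 0" for q
    proof -
      have le: "norm (1 - phase a (Complex p0 q)) \<ge> 1/2" 
        using a by (intro norm_one_minus_phase_ge_half[where j = J]) (auto simp: p0_def)
      then show "1 - phase a (Complex p0 q) \<noteq> 0" by auto
      have "1 / norm (1 - phase a (Complex p0 q)) \<le> 1 / (1/2)"
        using le by (intro divide_left_mono) (auto intro!: mult_pos_pos)
      then show "norm (\<Phi> (Complex p0 q)) \<le> 2" by (simp add: \<Phi>_def norm_divide)
    qed
    have nzL: "complex_of_real y + exp (Complex p0 q / a) \<noteq> 0" if "\<bar>q\<bar> \<le> h" for q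
    proof -
      have "h < 3 * pi * a" using a by (simp add: h_def)
      then have "\<bar>Im (Complex p0 q)\<bar> < 3 * pi * a" using that by simp
      from stieltjes_kernel_pole_iff[OF a y this] show ?thesis using yne by simp
    qed
    have contL: "continuous_on A (\<lambda>q. stieltjes_kernel a y (Complex p0 q))" if "A \<subseteq> {-h..h}" for A
      using that a nzL
      by (intro continuous_on_stieltjes_kernel continuous_on_Complex) (force simp: abs_le_iff subset_iff intro: continuous_intros)+
    have contPL: "continuous_on A (\<lambda>q. \<Phi> (Complex p0 q))" for A
      unfolding \<Phi>_def using a PhiL0 by (intro continuous_intros continuous_on_phase) auto
    have Lb: "norm Lb \<le> K * h"
      unfolding Lb_def using integral_bound[of "-h" 0 "\<lambda>q. stieltjes_kernel a y (Complex p0 q)" K] h kL contL by simp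
    have L: "norm L \<le> (K * 2) * (2 * h)"
    proof -
      have "norm L \<le> (K * 2) * (h - - h)"
        unfolding L_def using h K
        by (intro integral_bound continuous_intros contL contPL) (auto simp: norm_mult intro!: mult_mono kL PhiL)
      then show ?thesis by simp
    qed
    have res: "norm (exp wp * \<Phi> wp) \<le> C2" "norm (exp wm * (\<Phi> wm - 1)) \<le> C2" if "p0 < x"
    proof -
      have C2': "exp x * (exp (- x) / (1 - exp (- x))) \<le> C2"
      proof -
        have "exp x * (exp (- x) / (1 - exp (- x))) = 1 / (1 - exp (- x))" by (simp add: exp_minus)
        also have "\<dots> \<le> C2" unfolding C2_def using that p0 by (intro divide_left_mono mult_pos_pos) auto
        finally show ?thesis .
      qed
      have X: "Re wp * Im wp / (pi * a) = x" "Re wm * Im wm / (pi * a) = - x"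
        using a by (auto simp: wp_def wm_def)
      have n: "norm (exp wp) = exp x" "norm (exp wm) = exp x" by (auto simp: wp_def wm_def)
      have "norm (\<Phi> wp) \<le> exp (- x) / (1 - exp (- x))"
        using norm_trapezoid_factor_le(1)[of "phase a wp" x] X that p0 by (simp add: \<Phi>_def norm_phase)
      then have "norm (exp wp * \<Phi> wp) \<le> exp x * (exp (- x) / (1 - exp (- x)))" by (simp only: norm_mult n mult_le_cancel_left_pos exp_gt_zero)
      then show "norm (exp wp * \<Phi> wp) \<le> C2" using C2' by simp
      have "norm (\<Phi> wm - 1) \<le> exp (- x) / (1 - exp (- x))"
        using norm_trapezoid_factor_le(2)[of "phase a wm" "- x"] X that p0 by (simp add: \<Phi>_def norm_phase)
      then have "norm (exp wm * (\<Phi> wm - 1)) \<le> exp x * (exp (- x) / (1 - exp (- x)))" by (simp only: norm_mult n mult_le_cancel_left_pos exp_gt_zero)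
      then show "norm (exp wm * (\<Phi> wm - 1)) \<le> C2" using C2' by simp
    qed
    have resI: "norm (ind * (2 * pi * \<i> * a * (exp wp * \<Phi> wp + exp wm * (\<Phi> wm - 1)))) \<le> 2 * pi * a * (C2 + C2)"
    proof (cases "p0 < x")
      case True
      have "norm (exp wp * \<Phi> wp + exp wm * (\<Phi> wm - 1)) \<le> C2 + C2"
        using res[OF True] by (intro norm_triangle_le add_mono)
      then have "2 * pi * a * norm (exp wp * \<Phi> wp + exp wm * (\<Phi> wm - 1)) \<le> 2 * pi * a * (C2 + C2)"
        using a by (intro mult_left_mono) auto
      then show ?thesis using True a by (simp add: ind_def norm_mult)
    qed (use a C2 in \<open>auto simp: ind_def\<close>)
    \<comment> \<open>If the poles lie to the left of the contour, the main term is itself bounded.\<close>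
    have out: "norm ((1 - ind) * (\<kappa> * y powr a)) \<le> \<bar>\<kappa>\<bar> * exp p0"
    proof (cases "p0 < x")
      case False
      then have "\<bar>\<kappa>\<bar> * (y powr a) \<le> \<bar>\<kappa>\<bar> * exp p0" using y by (intro mult_left_mono) (auto simp: x_def powr_def mult.commute)
      then show ?thesis using False by (simp add: ind_def norm_mult abs_mult)
    qed (auto simp: ind_def)
    have main_term: "ind * (2 * pi * \<i> * a * exp wm) * (1 - \<mu>) = ind * (\<kappa> * y powr a)"
      using res_main by (simp add: mult.assoc)
    have "\<Sigma> - \<kappa> * y powr a - \<i> * (R - \<mu> * Rb) = \<i> * \<mu> * Lb + bs - tp - \<i> * L
       + ind * (2 * pi * \<i> * a * (exp wp * \<Phi> wp + exp wm * (\<Phi> wm - 1)))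
       + ind * (2 * pi * \<i> * a * exp wm) * (1 - \<mu>) - \<kappa> * y powr a"
      unfolding A bt b0 by (simp add: algebra_simps)
    also have "\<dots> = \<i> * \<mu> * Lb + bs - tp - \<i> * L
       + ind * (2 * pi * \<i> * a * (exp wp * \<Phi> wp + exp wm * (\<Phi> wm - 1))) - (1 - ind) * (\<kappa> * y powr a)"
      unfolding main_term by (simp add: algebra_simps)
    finally have eq: "\<Sigma> - \<kappa> * y powr a - \<i> * (R - \<mu> * Rb) = \<dots>" .
    have "norm (\<Sigma> - \<kappa> * y powr a - \<i> * (R - \<mu> * Rb)) \<le> norm (\<i> * \<mu> * Lb) + norm bs + norm tp + norm (\<i> * L)
       + norm (ind * (2 * pi * \<i> * a * (exp wp * \<Phi> wp + exp wm * (\<Phi> wm - 1)))) + norm ((1 - ind) * (\<kappa> * y powr a))"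
      unfolding eq by (smt (verit, best) norm_triangle_ineq norm_triangle_ineq4)
    moreover have "norm (\<i> * \<mu> * Lb) \<le> norm \<mu> * (K * h)" using Lb by (simp add: norm_mult mult_left_mono)
    moreover have "norm (\<i> * L) \<le> 2 * K * (2 * h)" using L by (simp add: norm_mult)
    ultimately show ?thesis
      using bs tp resI out unfolding C_def \<Sigma>_def[symmetric] R_def[symmetric] Rb_def[symmetric] by linarith
  qed
  show ?thesis
    using main unfolding right_edge_def h_def p0_def \<Phi>_def \<mu>_def \<kappa>_def by blast
qed

section \<open>Polynomial approximation of the right edge\<close>

lemma stieltjes_kernel_expansion:
  assumes z: "z = - (y / exp (w / complex_of_real a))" "z \<noteq> 1"
  shows "stieltjes_kernel a y w = - (exp w * (\<Sum>k=1..m. z ^ k)) - exp w * z ^ Suc m / (1 - z)"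
proof -
  have "complex_of_real y + exp (w / a) = exp (w / a) * (1 - z)" "complex_of_real y = - z * exp (w / a)"
    using z by (auto simp: field_simps)
  then have base: "stieltjes_kernel a y w = - (exp w * z / (1 - z))"
    using z(2) by (simp add: stieltjes_kernel_def)
  show ?thesis
  proof (induction m)
    case 0
    show ?case unfolding base by simp
  next
    case (Suc m)
    have "exp w * z ^ Suc m / (1 - z) = exp w * z ^ Suc m + exp w * z ^ Suc (Suc m) / (1 - z)"
      using z(2) by (simp add: field_simps)
    then show ?case unfolding Suc by (simp add: algebra_simps)
  qed
qed

text \<open>For \<open>y \<le> exp (p / a - 1)\<close> the geometric series has ratio at most \<open>exp (- 1)\<close>, so \<open>m \<ge> p\<close> terms reduce the
  factor \<open>exp p\<close> of the kernel to a constant. The coefficients \<open>c\<close> do not depend on \<open>y\<close>.\<close>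

lemma vertical_integral_near_polynomial:
  assumes a: "a > 0" and st: "s \<le> t" and g: "continuous_on {s..t} g" "\<And>q. q \<in> {s..t} \<Longrightarrow> norm (g q) \<le> B"
    and m: "real m \<ge> p"
  shows "\<exists>c. \<forall>y. 0 \<le> y \<longrightarrow> y \<le> exp (p / a - 1) \<longrightarrow>
     norm (integral {s..t} (\<lambda>q. stieltjes_kernel a y (Complex p q) * g q) - (\<Sum>k=1..m. c k * complex_of_real (y ^ k))) \<le> B * (t - s)"
proof -
  define c where "c = (\<lambda>k. integral {s..t} (\<lambda>q. - (exp (Complex p q) * (- exp (- (Complex p q / a))) ^ k * g q)))"
  have cont: "continuous_on {s..t} (\<lambda>q. - (exp (Complex p q) * (- exp (- (Complex p q / a))) ^ k * g q))" for k
    using a by (intro continuous_intros continuous_on_Complex g) auto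
  have "norm (integral {s..t} (\<lambda>q. stieltjes_kernel a y (Complex p q) * g q) - (\<Sum>k=1..m. c k * complex_of_real (y ^ k))) \<le> B * (t - s)"
    if y: "0 \<le> y" "y \<le> exp (p / a - 1)" for y
  proof -
    let ?z = "\<lambda>q. - (y / exp (Complex p q / complex_of_real a))"
    have nz: "norm (?z q) \<le> exp (- 1)" for q
    proof -
      have "norm (?z q) = y / exp (p / a)" using y by (simp add: norm_divide)
      also have "\<dots> \<le> exp (p / a - 1) / exp (p / a)" using y by (intro divide_right_mono) auto
      finally show ?thesis by (simp add: exp_diff exp_minus field_simps)
    qed
    have e1: "exp (-1::real) \<le> 1/2" using exp_ge_add_one_self[of "1::real"] by (simp add: exp_minus field_simps)
    have z1: "norm (1 - ?z q) \<ge> 1/2" for q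
      using norm_triangle_ineq2[of 1 "?z q"] nz[of q] e1 by simp
    have z1': "?z q \<noteq> 1" for q
    proof
      assume "?z q = 1"
      with z1[of q] show False by (simp only: diff_self norm_zero)
    qed
    let ?T = "\<lambda>q. \<Sum>k=1..m. - (exp (Complex p q) * (- exp (- (Complex p q / a))) ^ k * g q) * complex_of_real (y ^ k)"
    have "?z q = - exp (- (Complex p q / a)) * complex_of_real y" for q
      by (simp add: exp_minus field_simps)
    then have zk: "?z q ^ k = (- exp (- (Complex p q / a))) ^ k * complex_of_real (y ^ k)" for q k
      by (simp only: power_mult_distrib of_real_power)
    have T: "?T q = - (exp (Complex p q) * (\<Sum>k=1..m. ?z q ^ k)) * g q" for q
      unfolding zk sum_distrib_left sum_distrib_right sum_negf[symmetric] by (intro sum.cong) (auto simp: mult_ac)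
    have sum: "(\<Sum>k=1..m. c k * complex_of_real (y ^ k)) = integral {s..t} ?T"
      unfolding c_def
      by (subst integral_sum)
         (simp_all only: finite_atLeastAtMost integrable_continuous_real continuous_on_mult_right cont integral_mult_left)
    have "integral {s..t} (\<lambda>q. stieltjes_kernel a y (Complex p q) * g q) - (\<Sum>k=1..m. c k * complex_of_real (y ^ k)) =
      integral {s..t} (\<lambda>q. stieltjes_kernel a y (Complex p q) * g q) - integral {s..t} ?T"
      by (simp only: sum)
    also have "\<dots> = integral {s..t} (\<lambda>q. stieltjes_kernel a y (Complex p q) * g q - ?T q)"
    proof (rule integral_diff[symmetric])
      show "?T integrable_on {s..t}" by (intro integrable_continuous_real continuous_on_sum continuous_on_mult_right cont)
      have "complex_of_real y + exp (Complex p q / a) \<noteq> 0" for q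
        using z1'[of q] by (auto simp: field_simps add_eq_0_iff)
      then show "(\<lambda>q. stieltjes_kernel a y (Complex p q) * g q) integrable_on {s..t}"
        using a by (intro integrable_continuous_real continuous_on_mult continuous_on_stieltjes_kernel continuous_on_Complex continuous_on_const continuous_on_id g(1))
          simp_all
    qed
    also have "\<dots> = integral {s..t} (\<lambda>q. - (exp (Complex p q) * ?z q ^ Suc m / (1 - ?z q) * g q))"
    proof (rule integral_cong)
      fix q
      have alg: "(- X - Z) * G - (- X) * G = - (Z * G)" for X Z G :: complex by (simp add: algebra_simps)
      show "stieltjes_kernel a y (Complex p q) * g q - ?T q = - (exp (Complex p q) * ?z q ^ Suc m / (1 - ?z q) * g q)"
        unfolding T stieltjes_kernel_expansion[OF refl z1', of q m] by (rule alg)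
    qed
    finally have eq: "integral {s..t} (\<lambda>q. stieltjes_kernel a y (Complex p q) * g q) - (\<Sum>k=1..m. c k * complex_of_real (y ^ k)) = \<dots>" .
    show ?thesis unfolding eq
    proof (rule integral_bound[OF st])
      have "1 - ?z q \<noteq> 0" for q using z1[of q] by (metis norm_zero not_numeral_le_zero zero_less_divide_1_iff not_le zero_less_numeral)
      then show "continuous_on {s..t} (\<lambda>q. - (exp (Complex p q) * ?z q ^ Suc m / (1 - ?z q) * g q))"
        using a by (intro continuous_intros continuous_on_Complex g(1)) auto
      fix q assume q: "q \<in> {s..t}"
      have "exp p * norm (?z q) ^ Suc m / norm (1 - ?z q) \<le> exp p * exp (- 1) ^ Suc m / (1/2)"
        using nz[of q] z1[of q] by (intro frac_le mult_left_mono power_mono) auto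
      also have "\<dots> = exp (p - real m) * (2 * exp (- 1))"
        by (simp add: exp_diff exp_minus power_inverse exp_of_nat_mult[symmetric] field_simps)
      also have "\<dots> \<le> 1 * 1" using m e1 by (intro mult_mono) auto
      finally have "norm (exp (Complex p q) * ?z q ^ Suc m / (1 - ?z q)) \<le> 1"
        by (simp add: norm_mult norm_divide norm_power del: power_Suc)
      then have "norm (exp (Complex p q) * ?z q ^ Suc m / (1 - ?z q)) * norm (g q) \<le> 1 * B"
        using g(2)[OF q] by (intro mult_mono) auto
      then show "norm (- (exp (Complex p q) * ?z q ^ Suc m / (1 - ?z q) * g q)) \<le> B"
        by (simp only: norm_minus_cancel norm_mult mult_1)
    qed
  qed
  then show ?thesis by blast
qed

text \<open>If \<open>a ln y\<close> is too close to the left edge at \<open>node a (1/2)\<close>, then it keeps its distance from the one at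
  \<open>node a (3/2)\<close>, and the contour starts there. The right edge, hence \<open>P\<close>, is the same in both cases.\<close>

lemma power_approx_large_interval:
  assumes a: "a > 0" and sin: "sin (pi * a) \<noteq> 0"
  shows "\<exists>C. \<forall>M m. M \<ge> 2 \<longrightarrow> node a (real M + 1/2) \<le> real m \<longrightarrow>
    (\<exists>P::real poly. degree P \<le> m \<and> (\<forall>y. 0 \<le> y \<longrightarrow> y \<le> exp (node a (real M + 1/2) / a - 1) \<longrightarrow>
      \<bar>(\<Sum>j=1..M. 2 * pi\<^sup>2 * a / node a (real j) * (exp (node a (real j)) * y / (y + exp (node a (real j) / a))))
        - pi * a / sin (pi * a) * y powr a - poly P y\<bar> \<le> C))"
proof -
  define h where "h = 2 * pi * a"
  define \<kappa> where "\<kappa> = pi * a / sin (pi * a)"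
  define \<mu> where "\<mu> = 1 / (1 - exp (2 * pi * \<i> * a))"
  define \<delta> where "\<delta> = (node a (3/2) - node a (1/2)) / 2"
  define W where "W = (\<lambda>j. 2 * pi\<^sup>2 * a / node a (real j))"
  have V: "right_edge a M y = integral {- h..h}
       (\<lambda>q. stieltjes_kernel a y (Complex (node a (real M + 1/2)) q) * (1 / (1 - phase a (Complex (node a (real M + 1/2)) q))))
     - \<mu> * integral {- h..0} (\<lambda>q. stieltjes_kernel a y (Complex (node a (real M + 1/2)) q))" for M y
    by (simp add: right_edge_def h_def \<mu>_def)
  have h: "h > 0" using a by (simp add: h_def)
  have d: "\<delta> > 0" unfolding \<delta>_def using node_mono[OF a, of "1/2" "3/2"] by simp
  obtain C0 where C0: "norm ((\<Sum>j=0+1..M. complex_of_real (W j) * stieltjes_kernel a y (node a (real j)))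
      - \<kappa> * y powr a - \<i> * right_edge a M y) \<le> C0" 
    if "0 < M" "y > 0" "a * ln y < node a (real M + 1/2)" "\<bar>a * ln y - node a (1/2)\<bar> \<ge> \<delta>" for M y
    using trapezoid_error[OF a sin d, of 0] unfolding W_def \<kappa>_def of_nat_0 add_0_left by blast
  obtain C1 where C1: "norm ((\<Sum>j=1+1..M. complex_of_real (W j) * stieltjes_kernel a y (node a (real j)))
      - \<kappa> * y powr a - \<i> * right_edge a M y) \<le> C1" 
    if "1 < M" "y > 0" "a * ln y < node a (real M + 1/2)" "\<bar>a * ln y - node a (1 + 1/2)\<bar> \<ge> \<delta>" for M y
    using trapezoid_error[OF a sin d, of 1] unfolding W_def \<kappa>_def of_nat_1 by blast
  define D where "D = \<bar>C0\<bar> + (\<bar>C1\<bar> + \<bar>W 1\<bar> * exp (node a 1))"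
  define C where "C = D + (2 * (h - - h) + norm \<mu> * (1 * (0 - - h)))"
  have kernel_real: "stieltjes_kernel a y (complex_of_real v) = complex_of_real (exp v * y / (y + exp (v / a)))" for y v
    by (simp add: stieltjes_kernel_def exp_of_real[symmetric])
  have both: "norm ((\<Sum>j=1..M. complex_of_real (W j) * stieltjes_kernel a y (node a (real j))) - \<kappa> * y powr a - \<i> * right_edge a M y) \<le> D"
    if M: "M \<ge> 2" and y: "0 \<le> y" "y \<le> exp (node a (real M + 1/2) / a - 1)" for M y
  proof (cases "y = 0")
    case True
    then have "stieltjes_kernel a y = (\<lambda>w. 0)" by (simp add: stieltjes_kernel_def fun_eq_iff)
    then show ?thesis using True by (simp add: V D_def add_nonneg_nonneg)
  next
    case False
    then have y0: "y > 0" using y by simp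
    then have "ln y \<le> node a (real M + 1/2) / a - 1" using y by (metis ln_exp ln_le_cancel_iff exp_gt_zero)
    then have "a * ln y \<le> a * (node a (real M + 1/2) / a - 1)" using a by (intro mult_left_mono) auto
    then have lny: "a * ln y < node a (real M + 1/2)" using a by (simp add: right_diff_distrib)
    show ?thesis
    proof (cases "\<bar>a * ln y - node a (1/2)\<bar> \<ge> \<delta>")
      case True
      have "norm ((\<Sum>j=1..M. complex_of_real (W j) * stieltjes_kernel a y (node a (real j))) - \<kappa> * y powr a - \<i> * right_edge a M y) \<le> C0"
        using C0[OF _ y0 lny True] M by simp
      also have "C0 \<le> D" unfolding D_def by (smt (verit) mult_nonneg_nonneg exp_ge_zero)
      finally show ?thesis .
    next
      case False
      then have far: "\<bar>a * ln y - node a (1 + 1/2)\<bar> \<ge> \<delta>" unfolding \<delta>_def by (simp add: abs_if not_le split: if_splits)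
      have n: "norm ((\<Sum>j=1+1..M. complex_of_real (W j) * stieltjes_kernel a y (node a (real j))) - \<kappa> * y powr a - \<i> * right_edge a M y) \<le> C1"
        using C1[OF _ y0 lny far] M by simp
      have split: "(\<Sum>j=1..M. complex_of_real (W j) * stieltjes_kernel a y (node a (real j))) = 
         complex_of_real (W 1) * stieltjes_kernel a y (node a (real 1)) + (\<Sum>j=1+1..M. complex_of_real (W j) * stieltjes_kernel a y (node a (real j)))"
        using M by (subst sum.atLeast_Suc_atMost) auto
      have "norm (stieltjes_kernel a y (node a (real 1))) = exp (node a 1) * (y / (y + exp (node a 1 / a)))"
        unfolding kernel_real norm_of_real using y0 by (simp add: add_pos_pos)
      also have "\<dots> \<le> exp (node a 1) * 1" using y0 by (intro mult_left_mono) (auto simp: divide_le_eq add_pos_pos)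
      finally have first: "norm (complex_of_real (W 1) * stieltjes_kernel a y (node a (real 1))) \<le> \<bar>W 1\<bar> * exp (node a 1)"
        unfolding norm_mult norm_of_real by (intro mult_left_mono) auto
      have "norm ((\<Sum>j=1..M. complex_of_real (W j) * stieltjes_kernel a y (node a (real j))) - \<kappa> * y powr a - \<i> * right_edge a M y)
         \<le> norm (complex_of_real (W 1) * stieltjes_kernel a y (node a (real 1))) + 
           norm ((\<Sum>j=1+1..M. complex_of_real (W j) * stieltjes_kernel a y (node a (real j))) - \<kappa> * y powr a - \<i> * right_edge a M y)"
        unfolding split add_diff_eq[symmetric] by (rule norm_triangle_ineq)
      also have "\<dots> \<le> \<bar>W 1\<bar> * exp (node a 1) + C1" using first n by (rule add_mono)
      also have "\<dots> \<le> D" unfolding D_def by simp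
      finally show ?thesis .
    qed
  qed
  have "\<exists>P::real poly. degree P \<le> m \<and> (\<forall>y. 0 \<le> y \<longrightarrow> y \<le> exp (node a (real M + 1/2) / a - 1) \<longrightarrow>
      \<bar>(\<Sum>j=1..M. W j * (exp (node a (real j)) * y / (y + exp (node a (real j) / a))))
        - \<kappa> * y powr a - poly P y\<bar> \<le> C)" if M: "M \<ge> 2" and m: "node a (real M + 1/2) \<le> real m" for M m
  proof -
    define p where "p = node a (real M + 1/2)"
    have ge: "norm (1 - phase a (Complex p q)) \<ge> 1/2" for q
      using a by (intro norm_one_minus_phase_ge_half[where j = M]) (auto simp: p_def)
    \<comment> \<open>On the right edge the trapezoidal factor is bounded by 2, as on the left one.\<close>
    have nz: "1 - phase a (Complex p q) \<noteq> 0" for q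
    proof
      assume "1 - phase a (Complex p q) = 0"
      with ge[of q] show False by (simp only: norm_zero)
    qed
    have "\<exists>c. \<forall>y. 0 \<le> y \<longrightarrow> y \<le> exp (p / a - 1) \<longrightarrow>
       norm (integral {- h..h} (\<lambda>q. stieltjes_kernel a y (Complex p q) * (1 / (1 - phase a (Complex p q)))) - (\<Sum>k=1..m. c k * complex_of_real (y ^ k))) \<le> 2 * (h - - h)"
    proof (rule vertical_integral_near_polynomial[OF a])
      show "continuous_on {- h..h} (\<lambda>q. 1 / (1 - phase a (Complex p q)))"
        using a nz by (intro continuous_intros continuous_on_phase continuous_on_Complex) auto
      show "norm (1 / (1 - phase a (Complex p q))) \<le> 2" for q
        using ge[of q] nz[of q] by (simp add: norm_divide field_simps)
    qed (use h m p_def in auto)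
    then obtain c where c: "norm (integral {- h..h} (\<lambda>q. stieltjes_kernel a y (Complex p q) * (1 / (1 - phase a (Complex p q)))) - (\<Sum>k=1..m. c k * complex_of_real (y ^ k))) \<le> 2 * (h - - h)"
      if "0 \<le> y" "y \<le> exp (p / a - 1)" for y by blast
    have "\<exists>c. \<forall>y. 0 \<le> y \<longrightarrow> y \<le> exp (p / a - 1) \<longrightarrow>
       norm (integral {- h..0} (\<lambda>q. stieltjes_kernel a y (Complex p q) * 1) - (\<Sum>k=1..m. c k * complex_of_real (y ^ k))) \<le> 1 * (0 - - h)"
      using h m p_def by (intro vertical_integral_near_polynomial[OF a]) auto
    then obtain c' where c': "norm (integral {- h..0} (\<lambda>q. stieltjes_kernel a y (Complex p q)) - (\<Sum>k=1..m. c' k * complex_of_real (y ^ k))) \<le> 1 * (0 - - h)"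
      if "0 \<le> y" "y \<le> exp (p / a - 1)" for y by auto
    define P where "P = (\<Sum>k=1..m. monom (Re (\<i> * (c k - \<mu> * c' k))) k)"
    have "degree P \<le> m" unfolding P_def
      by (intro degree_sum_le) (auto intro: order_trans[OF degree_monom_le])
    moreover have "\<bar>(\<Sum>j=1..M. W j * (exp (node a (real j)) * y / (y + exp (node a (real j) / a))))
        - \<kappa> * y powr a - poly P y\<bar> \<le> C" if y: "0 \<le> y" "y \<le> exp (p / a - 1)" for y
    proof -
      let ?S1 = "\<Sum>k=1..m. c k * complex_of_real (y ^ k)" and ?S2 = "\<Sum>k=1..m. c' k * complex_of_real (y ^ k)"
      have P: "poly P y = Re (\<i> * (?S1 - \<mu> * ?S2))"
        unfolding P_def poly_sum poly_monom sum_distrib_left sum_subtractf[symmetric] Re_sum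
        by (intro sum.cong refl) (simp add: algebra_simps)
      have "norm (\<i> * (right_edge a M y - (?S1 - \<mu> * ?S2))) = norm ((integral {- h..h} (\<lambda>q. stieltjes_kernel a y (Complex p q) * (1 / (1 - phase a (Complex p q)))) - ?S1)
          - \<mu> * (integral {- h..0} (\<lambda>q. stieltjes_kernel a y (Complex p q)) - ?S2))"
        unfolding V p_def[symmetric] norm_mult by (simp add: algebra_simps)
      also have "\<dots> \<le> 2 * (h - - h) + norm \<mu> * (1 * (0 - - h))"
        by (rule order_trans[OF norm_triangle_ineq4], unfold norm_mult) (intro add_mono mult_left_mono c c' y norm_ge_zero)
      finally have v: "norm (\<i> * (right_edge a M y - (?S1 - \<mu> * ?S2))) \<le> 2 * (h - - h) + norm \<mu> * (1 * (0 - - h))" .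
      let ?X = "(\<Sum>j=1..M. complex_of_real (W j) * stieltjes_kernel a y (node a (real j))) - \<kappa> * y powr a - \<i> * right_edge a M y"
      have "(\<Sum>j=1..M. W j * (exp (node a (real j)) * y / (y + exp (node a (real j) / a)))) - \<kappa> * y powr a - poly P y
        = Re (?X + \<i> * (right_edge a M y - (?S1 - \<mu> * ?S2)))"
        unfolding P by (simp add: kernel_real algebra_simps)
      also have "\<bar>\<dots>\<bar> \<le> norm (?X + \<i> * (right_edge a M y - (?S1 - \<mu> * ?S2)))" by (rule abs_Re_le_cmod)
      also have "\<dots> \<le> C" unfolding C_def
        using both[OF M y(1)] y(2) v by (intro norm_triangle_le add_mono) (auto simp: p_def)
      finally show ?thesis .
    qed
    ultimately show ?thesis unfolding p_def by blast
  qed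
  then show ?thesis unfolding W_def \<kappa>_def by blast
qed

section \<open>Rational approximation of powers on the unit interval\<close>

lemma stieltjes_sum_rational:
  fixes b A :: "nat \<Rightarrow> real"
  assumes "\<And>j. b j > 0"
  shows "\<exists>P Q. degree P \<le> M \<and> degree Q \<le> M \<and> (\<forall>t\<ge>0. poly Q t > 0 \<and> (\<Sum>j=1..M. A j * t / (t + b j)) = poly P t / poly Q t)"
proof (induction M)
  case 0
  show ?case by (intro exI[of _ 0] exI[of _ 1]) auto
next
  case (Suc M)
  then obtain P Q where PQ: "degree P \<le> M" "degree Q \<le> M"
    "\<And>t. t \<ge> 0 \<Longrightarrow> poly Q t > 0" "\<And>t. t \<ge> 0 \<Longrightarrow> (\<Sum>j=1..M. A j * t / (t + b j)) = poly P t / poly Q t" by blast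
  let ?L = "[:b (Suc M), 1:]"
  let ?P = "P * ?L + [:0, A (Suc M):] * Q"
  have "degree (P * ?L) \<le> Suc M" "degree ([:0, A (Suc M):] * Q) \<le> Suc M"
    using PQ(1,2) degree_mult_le[of P ?L] degree_mult_le[of "[:0, A (Suc M):]" Q]
    by (auto intro: order_trans split: if_splits)
  then have "degree ?P \<le> Suc M" by (rule degree_add_le)
  moreover have "degree (Q * ?L) \<le> Suc M" using degree_mult_le[of Q ?L] PQ(2) by simp
  moreover have "poly (Q * ?L) t > 0 \<and> (\<Sum>j=1..Suc M. A j * t / (t + b j)) = poly ?P t / poly (Q * ?L) t" if "t \<ge> 0" for t
  proof -
    define d where "d = t + b (Suc M)"
    have d: "d > 0" using that assms[of "Suc M"] by (simp add: d_def)
    have Q: "poly Q t > 0" using PQ(3) that by simp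
    have "(\<Sum>j=1..Suc M. A j * t / (t + b j)) = poly P t / poly Q t + A (Suc M) * t / d"
      using PQ(4)[OF that] by (simp add: d_def)
    also have "\<dots> = (poly P t * d + A (Suc M) * t * poly Q t) / (poly Q t * d)"
      using d Q by (simp add: field_simps)
    also have "poly P t * d + A (Suc M) * t * poly Q t = poly ?P t"
      by (simp add: d_def algebra_simps)
    finally have "(\<Sum>j=1..Suc M. A j * t / (t + b j)) = poly ?P t / (poly Q t * d)" .
    moreover have "poly (Q * ?L) t = poly Q t * d" by (simp add: d_def algebra_simps)
    ultimately show ?thesis using d Q by simp
  qed
  ultimately show ?case by blast
qed

text \<open>Lowering the number of nodes from \<open>k\<close> by \<open>m = O(sqrt k)\<close> lowers \<open>sqrt k\<close> by about \<open>m / (2 sqrt k) = O(1)\<close>.\<close>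

lemma node_diff_bounded:
  assumes a: "a > 0" and m: "m \<le> k" "k \<ge> 1" and nm: "real m \<le> node a (real k + 1) + 1"
  shows "node a k - node a (k - m) \<le> node a 1 * (2 * node a 1 + 1)"
proof -
  let ?s = "sqrt (real k)"
  have c: "node a 1 > 0" using a by (intro node_pos) auto
  have node: "node a v = node a 1 * sqrt v" for v by (simp add: node_def real_sqrt_mult)
  have s1: "?s \<ge> 1" using m by simp
  have "real k + 1 \<le> 4 * real k" using m by simp
  then have "sqrt (real k + 1) \<le> 2 * ?s" by (metis real_sqrt_four real_sqrt_le_mono real_sqrt_mult)
  then have "real m \<le> node a 1 * (2 * ?s) + 1" using nm c unfolding node[of "real k + 1"]
    by (smt (verit) mult_left_mono)
  also have "\<dots> \<le> (2 * node a 1 + 1) * ?s" using s1 by (simp add: algebra_simps)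
  finally have "real m / ?s \<le> 2 * node a 1 + 1" using s1 by (simp add: divide_le_eq)
  have "(?s - sqrt (real (k - m))) * ?s \<le> (?s - sqrt (real (k - m))) * (?s + sqrt (real (k - m)))"
    by (intro mult_left_mono) auto
  also have "\<dots> = real k - real (k - m)" by (simp add: algebra_simps)
  also have "\<dots> = real m" using m by (simp add: of_nat_diff)
  finally have "?s - sqrt (real (k - m)) \<le> real m / ?s" using s1 by (simp add: le_divide_eq)
  then have "?s - sqrt (real (k - m)) \<le> 2 * node a 1 + 1" using \<open>real m / ?s \<le> _\<close> by linarith
  then have "node a 1 * (?s - sqrt (real (k - m))) \<le> node a 1 * (2 * node a 1 + 1)" using c by (intro mult_left_mono) auto
  then show ?thesis unfolding node[of "real k"] node[of "real (k - m)"] by (simp add: algebra_simps)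
qed

text \<open>Of the degree \<open>k\<close>, the part \<open>m \<ge> node a (k + 1)\<close> is spent on the polynomial and \<open>M = k - m\<close> on the
  poles. The substitution \<open>y = Y x\<close> uses the largest interval admitted by \<open>M\<close>, up to a constant factor of \<open>Y\<close>.\<close>

lemma rational_approx_powr:
  assumes a: "a > 0" and sin: "sin (pi * a) \<noteq> 0"
  shows "\<exists>C k0. C > 0 \<and> k0 \<ge> 1 \<and> (\<forall>k\<ge>k0. \<exists>r\<in>rational_functions k k. \<forall>x\<in>{0..1}.
    \<bar>x powr a - r x\<bar> \<le> C * exp (- 2 * pi * sqrt (a * real k)))"
proof -
  obtain C where C: "\<exists>P::real poly. degree P \<le> m \<and> (\<forall>y. 0 \<le> y \<longrightarrow> y \<le> exp (node a (real M + 1/2) / a - 1) \<longrightarrow>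
      \<bar>(\<Sum>j=1..M. 2 * pi\<^sup>2 * a / node a (real j) * (exp (node a (real j)) * y / (y + exp (node a (real j) / a))))
        - pi * a / sin (pi * a) * y powr a - poly P y\<bar> \<le> C)" if "M \<ge> 2" "node a (real M + 1/2) \<le> real m" for M m
    using power_approx_large_interval[OF a sin] by blast
  define \<kappa> where "\<kappa> = pi * a / sin (pi * a)"
  have k: "\<kappa> \<noteq> 0" using a sin by (simp add: \<kappa>_def)
  define c where "c = node a 1 * (2 * node a 1 + 1)"
  define C' where "C' = exp (a + c) * (\<bar>C\<bar> + 1) / \<bar>\<kappa>\<bar>"
  have "\<forall>\<^sub>F k in sequentially. 2 * pi * sqrt (a * (real k + 1)) + 1 \<le> real k - 2"
    using a by real_asymp
  then obtain k0 where k0: "node a (real k + 1) + 1 \<le> real k - 2" if "k \<ge> k0" for k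
    unfolding eventually_sequentially node_def by blast
  have "\<exists>r\<in>rational_functions k k. \<forall>x\<in>{0..1}. \<bar>x powr a - r x\<bar> \<le> C' * exp (- 2 * pi * sqrt (a * real k))"
    if kk: "k \<ge> max k0 1" for k
  proof -
    define m where "m = nat \<lceil>node a (real k + 1)\<rceil>"
    have npos: "node a (real k + 1) > 0" using a by (intro node_pos) auto
    have m: "node a (real k + 1) \<le> real m" "real m \<le> node a (real k + 1) + 1"
      unfolding m_def using npos by linarith+
    have mk: "m + 2 \<le> k" using m(2) k0[of k] kk by linarith
    define M where "M = k - m"
    have M: "M \<ge> 2" "M + m = k" using mk by (auto simp: M_def)
    define L where "L = node a M - a"
    define Y where "Y = exp (L / a)"
    have "node a (real M + 1/2) < node a (real k + 1)" using a M by (intro node_mono) auto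
    then have "node a (real M + 1/2) \<le> real m" using m by simp
    from C[OF M(1) this] obtain P :: "real poly" where P: "degree P \<le> m"
      "\<And>y. 0 \<le> y \<Longrightarrow> y \<le> exp (node a (real M + 1/2) / a - 1) \<Longrightarrow>
      \<bar>(\<Sum>j=1..M. 2 * pi\<^sup>2 * a / node a (real j) * (exp (node a (real j)) * y / (y + exp (node a (real j) / a))))
        - \<kappa> * y powr a - poly P y\<bar> \<le> C" unfolding \<kappa>_def by blast
    define A where "A = (\<lambda>j. exp (- L) / \<kappa> * (2 * pi\<^sup>2 * a / node a (real j) * exp (node a (real j))))"
    define b where "b = (\<lambda>j. exp (node a (real j) / a) / Y)"
    have Y: "Y > 0" by (simp add: Y_def)
    have b: "b j > 0" for j using Y by (simp add: b_def)
    obtain P1 Q1 where PQ: "degree P1 \<le> M" "degree Q1 \<le> M" "\<And>t. t \<ge> 0 \<Longrightarrow> poly Q1 t > 0"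
      "\<And>t. t \<ge> 0 \<Longrightarrow> (\<Sum>j=1..M. A j * t / (t + b j)) = poly P1 t / poly Q1 t"
      using stieltjes_sum_rational[of b M A] b by auto
    define P2 where "P2 = Polynomial.smult (exp (- L) / \<kappa>) (P \<circ>\<^sub>p [:0, Y:])"
    have "degree (P \<circ>\<^sub>p [:0, Y:]) \<le> m" using P(1) degree_pcompose_le[of P "[:0, Y:]"] by (auto split: if_splits)
    then have P2: "degree P2 \<le> m" unfolding P2_def by (rule order_trans[OF degree_smult_le])
    define r where "r = (\<lambda>t. poly (P1 - P2 * Q1) t / poly Q1 t)"
    have r_mem: "r \<in> rational_functions k k"
    proof -
      have "degree (P2 * Q1) \<le> k" using degree_mult_le[of P2 Q1] P2 PQ(2) M(2) by linarith
      then have "degree (P1 - P2 * Q1) \<le> k" using PQ(1) M(2) by (intro degree_diff_le) auto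
      moreover have "degree Q1 \<le> k" using PQ(2) M(2) by simp
      moreover have "\<forall>t\<in>{0..1}. poly Q1 t \<noteq> 0" using PQ(3) by (auto simp: less_imp_neq[symmetric])
      ultimately show ?thesis unfolding rational_functions_def r_def by blast
    qed
    have "\<bar>x powr a - r x\<bar> \<le> C' * exp (- 2 * pi * sqrt (a * real k))" if x: "x \<in> {0..1}" for x
    proof -
      define y where "y = Y * x"
      have y0: "0 \<le> y" using x Y by (simp add: y_def)
      have "y \<le> Y * 1" unfolding y_def using x Y by (intro mult_left_mono) auto
      also have "Y * 1 \<le> exp (node a (real M + 1/2) / a - 1)"
        using node_mono[OF a, of "real M" "real M + 1/2"] a by (simp add: Y_def L_def diff_divide_distrib divide_right_mono)
      finally have y1: "y \<le> exp (node a (real M + 1/2) / a - 1)" .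
      let ?S = "\<Sum>j=1..M. 2 * pi\<^sup>2 * a / node a (real j) * (exp (node a (real j)) * y / (y + exp (node a (real j) / a)))"
      have "Y powr a = exp L" using a by (simp add: Y_def powr_def)
      then have xy: "x powr a = exp (- L) / \<kappa> * (\<kappa> * y powr a)"
        using x Y k by (simp add: y_def powr_mult exp_minus)
      have "x / (x + b j) = y / (y + exp (node a (real j) / a))" for j
      proof -
        have "y / (y + exp (node a (real j) / a)) = (Y * x) / (Y * (x + b j))" using Y by (simp add: y_def b_def algebra_simps)
        then show ?thesis using Y by simp
      qed
      then have "A j * x / (x + b j) = exp (- L) / \<kappa> * (2 * pi\<^sup>2 * a / node a (real j) * (exp (node a (real j)) * y / (y + exp (node a (real j) / a))))" for j
        unfolding A_def times_divide_eq_right[symmetric] by (simp add: mult_ac)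
      then have S: "(\<Sum>j=1..M. A j * x / (x + b j)) = exp (- L) / \<kappa> * ?S"
        by (simp add: sum_distrib_left)
      have "poly Q1 x > 0" using PQ(3) x by simp
      then have "r x = poly P1 x / poly Q1 x - poly P2 x"
        by (simp add: r_def field_simps)
      also have "\<dots> = exp (- L) / \<kappa> * (?S - poly P y)"
        using PQ(4)[of x] x S by (simp add: P2_def poly_pcompose y_def algebra_simps)
      finally have "x powr a - r x = - (exp (- L) / \<kappa> * (?S - \<kappa> * y powr a - poly P y))"
        unfolding xy by (simp only: right_diff_distrib)
      then have "\<bar>x powr a - r x\<bar> = exp (- L) / \<bar>\<kappa>\<bar> * \<bar>?S - \<kappa> * y powr a - poly P y\<bar>"
        by (simp add: abs_mult)
      also have "\<dots> \<le> exp (- L) / \<bar>\<kappa>\<bar> * (\<bar>C\<bar> + 1)"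
        using P(2)[OF y0 y1] by (intro mult_left_mono) auto
      also have "\<dots> \<le> exp (a + c - node a k) / \<bar>\<kappa>\<bar> * (\<bar>C\<bar> + 1)"
      proof -
        have "node a k - node a M \<le> c"
          unfolding c_def M_def using node_diff_bounded[OF a _ _ m(2)] mk kk by simp
        then show ?thesis by (intro mult_right_mono divide_right_mono) (auto simp: L_def)
      qed
      also have "\<dots> = C' * exp (- 2 * pi * sqrt (a * real k))"
        by (simp add: C'_def node_def exp_diff exp_minus field_simps)
      finally show ?thesis .
    qed
    then show ?thesis using r_mem by blast
  qed
  moreover have "C' > 0" unfolding C'_def using k by simp
  ultimately show ?thesis by (intro exI[of _ C'] exI[of _ "max k0 1"]) auto
qed

text \<open>Continuity of \<open>f\<close> and \<open>r\<close> makes the supremum in \<^const>\<open>uniform_error\<close> bound the pointwise error.\<close>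

lemma best_rational_approx_error:
  assumes best: "best_rational_approx m k f r" and f: "continuous_on {0..1} f"
    and s: "s \<in> rational_functions m k" "\<And>x. x \<in> {0..1} \<Longrightarrow> \<bar>f x - s x\<bar> \<le> \<epsilon>"
    and x: "x \<in> {0..1}"
  shows "\<bar>f x - r x\<bar> \<le> \<epsilon>"
proof -
  have r: "r \<in> rational_functions m k" and le: "uniform_error f r \<le> uniform_error f s"
    using best s(1) by (auto simp: best_rational_approx_def is_arg_min_def not_less)
  have "continuous_on {0..1} r"
    using r by (auto simp: rational_functions_def intro!: continuous_intros)
  then have "compact ((\<lambda>t. \<bar>f t - r t\<bar>) ` {0..1})"
    using f by (intro compact_continuous_image continuous_intros) auto
  then have "bdd_above ((\<lambda>t. \<bar>f t - r t\<bar>) ` {0..1})"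
    by (intro bounded_imp_bdd_above compact_imp_bounded)
  then have "\<bar>f x - r x\<bar> \<le> uniform_error f r"
    unfolding uniform_error_def using x by (rule cSUP_upper2) simp
  also note le
  also have "uniform_error f s \<le> \<epsilon>"
    unfolding uniform_error_def using s(2) by (intro cSUP_least) auto
  finally show ?thesis .
qed

section \<open>The spectral theorem for real symmetric matrices\<close>

unbundle no inner_syntax and no vec_syntax
no_notation fps_nth (infixl \<open>$\<close> 75)



text \<open>The complexified matrix has an eigenvalue, which is real as the matrix is Hermitian. The real or the
  imaginary part of an eigenvector is then a real eigenvector.\<close>

lemma symmetric_real_eigenvector:
  fixes A :: "real mat"
  assumes A: "A \<in> carrier_mat n n" "transpose_mat A = A" and n: "n > 0"
  shows "\<exists>l v. v \<in> carrier_vec n \<and> v \<bullet> v = 1 \<and> A *\<^sub>v v = l \<cdot>\<^sub>v v"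
proof -
  let ?A = "map_mat complex_of_real A"
  have Ac: "?A \<in> carrier_mat n n" using A by simp
  obtain \<mu> z where z: "z \<in> carrier_vec n" "z \<noteq> 0\<^sub>v n" "?A *\<^sub>v z = \<mu> \<cdot>\<^sub>v z"
    using spectrum_non_empty[OF Ac n] Ac
    by (auto simp: spectrum_def eigenvalue_def eigenvector_def)
  have tr: "transpose_mat ?A = ?A"
    using A(2) by (metis transpose_mat_def map_mat_transpose)
  have conj: "conjugate (?A *\<^sub>v z) = ?A *\<^sub>v conjugate z"
    using A(1) z(1) by (intro eq_vecI) (auto simp: scalar_prod_def cnj_sum mult_mat_vec_def)
  have "\<mu> * (z \<bullet>c z) = (?A *\<^sub>v z) \<bullet>c z" using z by simp
  also have "\<dots> = z \<bullet> (?A *\<^sub>v conjugate z)"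
    using transpose_vec_mult_scalar[OF Ac, of "conjugate z" z] z(1) unfolding tr
    by simp
  also have "\<dots> = cnj \<mu> * (z \<bullet>c z)" unfolding conj[symmetric] z(3) using z(1) 
    by (simp add: conjugate_smult_vec)
  finally have "\<mu> = cnj \<mu>" using z(1,2) by simp
  then have im0: "Im \<mu> = 0" by (metis Reals_cnj_iff complex_is_Real_iff)
  have re: "A *\<^sub>v map_vec Re z = Re \<mu> \<cdot>\<^sub>v map_vec Re z" and im: "A *\<^sub>v map_vec Im z = Re \<mu> \<cdot>\<^sub>v map_vec Im z"
  proof -
    have "Re ((?A *\<^sub>v z) $ i) = (A *\<^sub>v map_vec Re z) $ i" "Im ((?A *\<^sub>v z) $ i) = (A *\<^sub>v map_vec Im z) $ i" if "i < n" for i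
      using that A(1) z(1) by (auto simp: scalar_prod_def)
    then show "A *\<^sub>v map_vec Re z = Re \<mu> \<cdot>\<^sub>v map_vec Re z" "A *\<^sub>v map_vec Im z = Re \<mu> \<cdot>\<^sub>v map_vec Im z"
      unfolding z(3) using A(1) z(1) im0 by (auto intro!: eq_vecI)
  qed
  have "map_vec Re z \<noteq> 0\<^sub>v n \<or> map_vec Im z \<noteq> 0\<^sub>v n"
  proof (rule ccontr)
    assume "\<not> ?thesis"
    then have "Re (z $ i) = 0" "Im (z $ i) = 0" if "i < n" for i
      using that z(1) by (metis carrier_vecD index_map_vec(1) index_zero_vec(1))+
    then have "z = 0\<^sub>v n" using z(1) by (intro eq_vecI) (auto simp: complex_eq_iff)
    then show False using z(2) by simp
  qed
  then obtain w where w: "w \<in> carrier_vec n" "w \<noteq> 0\<^sub>v n" "A *\<^sub>v w = Re \<mu> \<cdot>\<^sub>v w"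
    using re im z(1) by (metis map_carrier_vec)
  define v where "v = (1 / sqrt (w \<bullet> w)) \<cdot>\<^sub>v w"
  have ww: "w \<bullet> w > 0" using conjugate_square_greater_0_vec[OF w(1)] w(2) by simp
  have "v \<bullet> v = 1" using w(1) ww by (simp add: v_def)
  moreover have "A *\<^sub>v v = Re \<mu> \<cdot>\<^sub>v v" using w A(1) by (simp add: v_def mult_mat_vec smult_smult_assoc mult.commute)
  ultimately show ?thesis using w(1) by (intro exI[of _ "Re \<mu>"] exI[of _ v]) (simp add: v_def)
qed

text \<open>The reflection exchanges \<open>v\<close> and the first unit vector \<open>e\<close>: it is \<open>1 - c h h\<^sup>T\<close> with \<open>h = v - e\<close> and
  \<open>c = 2 / (h \<bullet> h)\<close>. If \<open>v = e\<close>, then \<open>c = 0\<close> by division by zero, and it is the identity.\<close>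

lemma householder_reflection:
  fixes v :: "real vec"
  assumes v: "v \<in> carrier_vec (Suc n)" "v \<bullet> v = 1"
  shows "\<exists>W. W \<in> carrier_mat (Suc n) (Suc n) \<and> transpose_mat W = W \<and> W * W = 1\<^sub>m (Suc n) \<and> col W 0 = v"
proof -
  define h where "h = (\<lambda>i. v $ i - (if i = 0 then 1 else 0))"
  define s where "s = (\<Sum>k<Suc n. h k * h k)"
  define c where "c = 2 / s"
  define W where "W = Matrix.mat (Suc n) (Suc n) (\<lambda>(i, j). (if i = j then 1 else 0) - c * h i * h j)"
  have W: "W \<in> carrier_mat (Suc n) (Suc n)" by (simp add: W_def)
  have "(\<Sum>k<Suc n. v $ k * v $ k) = 1" using v by (simp add: scalar_prod_def atLeast0LessThan)
  moreover have "h k * h k = v $ k * v $ k + (if k = 0 then 1 - 2 * v $ 0 else 0)" for k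
    by (simp add: h_def algebra_simps)
  ultimately have s: "s = 2 - 2 * v $ 0"
    unfolding s_def by (simp add: sum.distrib)
  have cs: "c * c * s = 2 * c" by (simp add: c_def)
  have "W * W = 1\<^sub>m (Suc n)"
  proof (rule eq_matI)
    fix i j assume ij: "i < dim_row (1\<^sub>m (Suc n) :: real mat)" "j < dim_col (1\<^sub>m (Suc n) :: real mat)"
    then have ij: "i < Suc n" "j < Suc n" by auto
    have "(W * W) $$ (i, j) = (\<Sum>k<Suc n. ((if i = k then 1 else 0) - c * h i * h k) * ((if k = j then 1 else 0) - c * h k * h j))"
      using ij by (simp add: W_def scalar_prod_def atLeast0LessThan)
    also have "\<dots> = (\<Sum>k<Suc n. (if k = i then (if i = j then 1 else 0) - c * h i * h j else 0) - (if k = j then c * h i * h j else 0)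
         + c * c * h i * h j * (h k * h k))"
      by (intro sum.cong) (auto simp: algebra_simps)
    also have "\<dots> = (if i = j then 1 else 0) - 2 * c * h i * h j + c * c * s * h i * h j"
      using ij by (simp add: sum.distrib sum_subtractf sum_distrib_left[symmetric] s_def[symmetric] del: sum.lessThan_Suc)
    also have "\<dots> = (if i = j then 1 else 0)" unfolding cs by simp
    finally show "(W * W) $$ (i, j) = 1\<^sub>m (Suc n) $$ (i, j)" using ij by simp
  qed (simp_all add: W_def)
  moreover have "transpose_mat W = W" by (rule eq_matI) (auto simp: W_def)
  moreover have "col W 0 = v"
  proof (rule eq_vecI)
    fix i assume "i < dim_vec v"
    then have i: "i < Suc n" using v by simp
    have "h i = 0" if "s = 0"
    proof -
      have "\<forall>k\<in>{..<Suc n}. h k * h k = 0"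
        using that unfolding s_def by (subst (asm) sum_nonneg_eq_0_iff) auto
      then show ?thesis using i by simp
    qed
    then have "c * h 0 * h i = - h i" unfolding c_def by (cases "s = 0") (simp_all add: s h_def field_simps)
    then have "(if i = 0 then 1 else 0) - c * h i * h 0 = v $ i" by (simp add: h_def mult_ac split: if_splits)
    then show "col W 0 $ i = v $ i" using i by (simp add: W_def)
  qed (use v in \<open>simp add: W_def\<close>)
  ultimately show ?thesis using W by blast
qed

text \<open>A Householder reflection moves an eigenvector to the first unit vector. By symmetry the first row and column
  of the conjugated matrix vanish off the diagonal, and the remaining block is treated by induction.\<close>

lemma symmetric_spectral_decomposition:
  fixes A :: "real mat"
  assumes "A \<in> carrier_mat n n" "transpose_mat A = A"
  shows "\<exists>U d. spectral_decomposition A U d"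
  using assms
proof (induction n arbitrary: A)
  case 0
  then show ?case by (intro exI[of _ "1\<^sub>m 0"]) (auto simp: spectral_decomposition_def intro!: eq_matI)
next
  case (Suc n)
  let ?n = "Suc n"
  note A = Suc.prems
  obtain l v where v: "v \<in> carrier_vec ?n" "v \<bullet> v = 1" "A *\<^sub>v v = l \<cdot>\<^sub>v v"
    using symmetric_real_eigenvector[OF A] by auto
  obtain W where W: "W \<in> carrier_mat ?n ?n" "transpose_mat W = W" "W * W = 1\<^sub>m ?n" "col W 0 = v"
    using householder_reflection[OF v(1,2)] by auto
  define B where "B = W * A * W"
  define B' where "B' = Matrix.mat n n (\<lambda>(i, j). B $$ (Suc i, Suc j))"
  have B: "B \<in> carrier_mat ?n ?n" unfolding B_def using A W by simp
  have Bt: "transpose_mat B = B"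
    unfolding B_def using A W by (simp add: transpose_mult[of _ ?n ?n _ ?n] assoc_mult_mat[of _ ?n ?n _ ?n _ ?n])
  have sym: "B $$ (i, j) = B $$ (j, i)" if "i < ?n" "j < ?n" for i j
    using that B Bt by (metis carrier_matD index_transpose_mat(1))
  have B': "B' \<in> carrier_mat n n" by (simp add: B'_def)
  have "transpose_mat B' = B'"
    by (rule eq_matI) (use sym in \<open>auto simp: B'_def\<close>)
  from Suc.IH[OF B' this] obtain U' d' where U': "U' \<in> carrier_mat n n" "transpose_mat U' * U' = 1\<^sub>m n"
    "U' * transpose_mat U' = 1\<^sub>m n" "B' = U' * mat_diag n d' * transpose_mat U'"
    using B' by (auto simp: spectral_decomposition_def)
  have col0: "col B 0 = l \<cdot>\<^sub>v unit_vec ?n 0"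
  proof -
    have "col B 0 = W *\<^sub>v (A *\<^sub>v v)"
      unfolding B_def using A W
      by (simp add: col_mult2[of _ ?n ?n _ ?n] assoc_mult_mat[of _ ?n ?n _ ?n _ ?n], simp add: mult_mat_vec_def)
    also have "\<dots> = l \<cdot>\<^sub>v (W *\<^sub>v col W 0)" using v W by (simp add: mult_mat_vec)
    also have "W *\<^sub>v col W 0 = col (W * W) 0" using W(1) by (subst col_mult2[of W ?n ?n W ?n 0]) auto
    finally show ?thesis using W(3) by simp
  qed
  have B0: "B $$ (i, 0) = (if i = 0 then l else 0)" if "i < ?n" for i
    using arg_cong[OF col0, of "\<lambda>x. vec_index x i"] that B by (auto split: if_splits)
  define F where "F = four_block_mat (1\<^sub>m 1) (0\<^sub>m 1 n) (0\<^sub>m n 1) U'"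
  define d where "d = (\<lambda>i. case i of 0 \<Rightarrow> l | Suc i \<Rightarrow> d' i)"
  have Ft: "transpose_mat F = four_block_mat (1\<^sub>m 1) (0\<^sub>m 1 n) (0\<^sub>m n 1) (transpose_mat U')"
    unfolding F_def using U' by (subst transpose_four_block_mat[of _ 1 1 _ n _ n]) auto
  have F: "F \<in> carrier_mat ?n ?n" unfolding F_def using four_block_carrier_mat[of "1\<^sub>m 1" 1 1 U' n n] U' by simp
  have D: "mat_diag ?n d = four_block_mat (mat_diag 1 (\<lambda>_. l)) (0\<^sub>m 1 n) (0\<^sub>m n 1) (mat_diag n d')"
    by (rule eq_matI) (auto simp: d_def mat_diag_def split: nat.splits)
  have Bblock: "B = four_block_mat (mat_diag 1 (\<lambda>_. l)) (0\<^sub>m 1 n) (0\<^sub>m n 1) B'"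
  proof (rule eq_matI)
    fix i j assume "i < dim_row (four_block_mat (mat_diag 1 (\<lambda>_. l)) (0\<^sub>m 1 n) (0\<^sub>m n 1) B')"
      "j < dim_col (four_block_mat (mat_diag 1 (\<lambda>_. l)) (0\<^sub>m 1 n) (0\<^sub>m n 1) B')"
    then have ij: "i < ?n" "j < ?n" using B' by (auto simp: mat_diag_def)
    show "B $$ (i, j) = four_block_mat (mat_diag 1 (\<lambda>_. l)) (0\<^sub>m 1 n) (0\<^sub>m n 1) B' $$ (i, j)"
      using ij B' B0[of i] B0[of j] sym[of 0 j] by (cases i; cases j) (auto simp: mat_diag_def B'_def)
  qed (use B B' in \<open>auto simp: mat_diag_def\<close>)
  have FF: "transpose_mat F * F = 1\<^sub>m ?n" "F * transpose_mat F = 1\<^sub>m ?n"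
    unfolding Ft unfolding F_def using U'
    by (subst mult_four_block_mat[of _ 1 1 _ n _ n _ _ 1 _ n]; simp add: four_block_one_mat[of 1 n, simplified])+
  have FB: "F * mat_diag ?n d * transpose_mat F = B"
  proof -
    let ?l = "mat_diag 1 (\<lambda>_. l)"
    have unit: "1\<^sub>m 1 * ?l = ?l" "?l * 1\<^sub>m 1 = ?l"
      using mat_diag_dim[of 1 "\<lambda>_. l"] by (rule left_mult_one_mat, rule right_mult_one_mat)
    have zero: "0\<^sub>m 1 n * mat_diag n d' = 0\<^sub>m 1 n" "0\<^sub>m n 1 * ?l = 0\<^sub>m n 1"
        "?l * 0\<^sub>m 1 n = 0\<^sub>m 1 n"
      by (rule left_mult_zero_mat[OF mat_diag_dim] right_mult_zero_mat[OF mat_diag_dim])+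
    have UD: "U' * mat_diag n d' \<in> carrier_mat n n" using U'(1) by (rule mult_carrier_mat) simp
    have block: "U' * mat_diag n d' * 0\<^sub>m n 1 = 0\<^sub>m n 1"
        "0\<^sub>m n n + U' * mat_diag n d' * transpose_mat U' = U' * mat_diag n d' * transpose_mat U'"
      using right_mult_zero_mat[OF UD] left_add_zero_mat[OF mult_carrier_mat[OF UD, of "transpose_mat U'" n]] U'(1) by auto
    have "F * mat_diag ?n d = four_block_mat ?l (0\<^sub>m 1 n) (0\<^sub>m n 1) (U' * mat_diag n d')"
      unfolding D F_def using U'(1)
      by (subst mult_four_block_mat[of _ 1 1 _ n _ n _ _ 1 _ n]) (simp_all add: unit zero del: One_nat_def)
    also have "\<dots> * transpose_mat F = B"
      unfolding Ft Bblock U'(4) using UD U'(1)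
      by (subst mult_four_block_mat[of _ 1 1 _ n _ n _ _ 1 _ n]) (simp_all add: unit zero block del: One_nat_def)
    finally show ?thesis .
  qed
  define U where "U = W * F"
  have "spectral_decomposition A U d"
  proof -
    have U: "U \<in> carrier_mat ?n ?n" unfolding U_def using W F by simp
    have Ft_c: "transpose_mat F \<in> carrier_mat ?n ?n" using F by simp
    have Ut: "transpose_mat U = transpose_mat F * W" unfolding U_def using W F by (simp add: transpose_mult)
    note assoc = assoc_mult_mat[where n\<^sub>1 = ?n and n\<^sub>2 = ?n and n\<^sub>3 = ?n and n\<^sub>4 = ?n]
    note mc = mult_carrier_mat[where nr = ?n and n = ?n and nc = ?n]
    have W_cancel: "W * (W * X) = X" if "X \<in> carrier_mat ?n ?n" for X
      using that W by (simp add: assoc[symmetric])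
    have "transpose_mat U * U = transpose_mat F * (W * (W * F))"
      unfolding U_def Ut[unfolded U_def] using W(1) F Ft_c by (simp add: assoc mc)
    then have "transpose_mat U * U = 1\<^sub>m ?n" using W_cancel[OF F] FF by simp
    moreover have "U * transpose_mat U = W * ((F * transpose_mat F) * W)"
      unfolding U_def Ut[unfolded U_def] using W(1) F Ft_c by (simp add: assoc mc)
    then have "U * transpose_mat U = 1\<^sub>m ?n" using W(1,3) FF by simp
    moreover have "U * mat_diag ?n d * transpose_mat U = W * ((F * mat_diag ?n d * transpose_mat F) * W)"
      unfolding U_def Ut[unfolded U_def] using W(1) F Ft_c by (simp add: assoc mc)
    then have "U * mat_diag ?n d * transpose_mat U = W * (W * (A * (W * W)))"
      unfolding FB B_def using W(1) A(1) by (simp add: assoc mc)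
    then have "A = U * mat_diag ?n d * transpose_mat U" using W A(1) W_cancel[OF A(1)] by simp
    ultimately show ?thesis using U A(1) by (simp add: spectral_decomposition_def)
  qed
  then show ?case by blast
qed

section \<open>From the scalar to the matrix estimate\<close>

lemma spectral_coordinate_matrix_fun:
  fixes A :: "real mat"
  assumes A: "A \<in> carrier_mat n n" and sd: "spectral_decomposition A U d" and x: "x \<in> carrier_vec n"
  shows "matrix_fun f A *\<^sub>v x \<in> carrier_vec n"
    and "i < n \<Longrightarrow> (transpose_mat U *\<^sub>v (matrix_fun f A *\<^sub>v x)) $ i = f (d i) * (transpose_mat U *\<^sub>v x) $ i"
    and "x \<bullet> (matrix_fun f A *\<^sub>v x) = (\<Sum>i<n. f (d i) * ((transpose_mat U *\<^sub>v x) $ i)\<^sup>2)"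
proof -
  have U: "U \<in> carrier_mat n n" "transpose_mat U * U = 1\<^sub>m n"
    using sd A by (auto simp: spectral_decomposition_def)
  let ?D = "mat_diag n (\<lambda>i. f (d i))"
  define c where "c = transpose_mat U *\<^sub>v x"
  have Ut: "transpose_mat U \<in> carrier_mat n n" using U by simp
  have c: "c \<in> carrier_vec n" unfolding c_def using Ut x by (rule mult_mat_vec_carrier)
  have D: "?D \<in> carrier_mat n n" by simp
  have Dc: "?D *\<^sub>v c \<in> carrier_vec n" using D c by (rule mult_mat_vec_carrier)
  have Dci: "(?D *\<^sub>v c) $ i = f (d i) * c $ i" if "i < n" for i
  proof -
    have "(?D *\<^sub>v c) $ i = (\<Sum>j = 0..<n. (if i = j then f (d j) else 0) * c $ j)"
      using that c by (simp add: mat_diag_def scalar_prod_def)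
    also have "\<dots> = (\<Sum>j = 0..<n. if i = j then f (d i) * c $ j else 0)" by (intro sum.cong) auto
    also have "\<dots> = f (d i) * c $ i" using that by simp
    finally show ?thesis .
  qed
  have F: "matrix_fun f A *\<^sub>v x = U *\<^sub>v (?D *\<^sub>v c)"
  proof -
    have "matrix_fun f A = U * ?D * transpose_mat U" using matrix_fun_eq[OF sd, of f] A by simp
    then have "matrix_fun f A *\<^sub>v x = (U * ?D) *\<^sub>v c"
      unfolding c_def using assoc_mult_mat_vec[OF mult_carrier_mat[OF U(1) D] Ut x] by simp
    also have "\<dots> = U *\<^sub>v (?D *\<^sub>v c)" by (rule assoc_mult_mat_vec[OF U(1) D c])
    finally show ?thesis .
  qed
  show "matrix_fun f A *\<^sub>v x \<in> carrier_vec n" unfolding F using U(1) Dc by (rule mult_mat_vec_carrier)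
  have "transpose_mat U *\<^sub>v (matrix_fun f A *\<^sub>v x) = (transpose_mat U * U) *\<^sub>v (?D *\<^sub>v c)"
    unfolding F by (rule assoc_mult_mat_vec[OF Ut U(1) Dc, symmetric])
  also have "\<dots> = ?D *\<^sub>v c" unfolding U(2) using Dc by (rule one_mult_mat_vec)
  finally show "(transpose_mat U *\<^sub>v (matrix_fun f A *\<^sub>v x)) $ i = f (d i) * (transpose_mat U *\<^sub>v x) $ i" if "i < n"
    using Dci[OF that] by (simp add: c_def)
  have "x \<bullet> (matrix_fun f A *\<^sub>v x) = c \<bullet> (?D *\<^sub>v c)"
    unfolding F c_def[symmetric] using transpose_vec_mult_scalar[OF U(1) Dc x] by (simp add: c_def)
  also have "\<dots> = (\<Sum>i<n. c $ i * (?D *\<^sub>v c) $ i)"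
    unfolding scalar_prod_def carrier_vecD[OF Dc] atLeast0LessThan ..
  also have "\<dots> = (\<Sum>i<n. f (d i) * (c $ i)\<^sup>2)"
    by (intro sum.cong) (auto simp: Dci power2_eq_square simp del: index_mult_mat_vec)
  finally show "x \<bullet> (matrix_fun f A *\<^sub>v x) = (\<Sum>i<n. f (d i) * ((transpose_mat U *\<^sub>v x) $ i)\<^sup>2)"
    by (simp only: c_def)
qed

lemma spd_mat_spectrum:
  assumes A: "spd_mat n A" and sd: "spectral_decomposition A U d" and i: "i < n"
  shows "eigenvalue A (d i)" "d i > 0"
proof -
  have Ac: "A \<in> carrier_mat n n" using A by (simp add: spd_mat_def)
  have U: "U \<in> carrier_mat n n" "transpose_mat U * U = 1\<^sub>m n" "A = U * mat_diag n d * transpose_mat U"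
    using sd Ac by (auto simp: spectral_decomposition_def)
  define v where "v = col U i"
  have v: "v \<in> carrier_vec n" unfolding v_def using i U(1) by (rule col_carrier_vec)
  have "v \<bullet> v = (transpose_mat U * U) $$ (i, i)" using U(1) i by (simp add: v_def)
  then have vv: "v \<bullet> v = 1" unfolding U(2) using i by simp
  then have v0: "v \<noteq> 0\<^sub>v n" using v by auto
  have AU: "A * U = U * mat_diag n d"
  proof -
    have "A * U = U * mat_diag n d * (transpose_mat U * U)"
      unfolding U(3) using U(1) by (intro assoc_mult_mat[of _ n n _ n _ n]) auto
    then show ?thesis unfolding U(2) using U(1) by (simp add: right_mult_one_mat[of _ n n])
  qed
  have "A *\<^sub>v v = col (A * U) i"
    unfolding v_def using Ac U(1) i by (intro col_mult2[symmetric]) auto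
  also have "\<dots> = d i \<cdot>\<^sub>v v"
    unfolding AU v_def mat_diag_mult_right[OF U(1)] using U(1) i by (intro eq_vecI) auto
  finally have Av: "A *\<^sub>v v = d i \<cdot>\<^sub>v v" .
  then show "eigenvalue A (d i)"
    unfolding eigenvalue_def eigenvector_def using v v0 Ac by auto
  have "v \<bullet> (A *\<^sub>v v) > 0" using A v v0 by (simp add: spd_mat_def)
  then show "d i > 0" unfolding Av using v vv by simp
qed

lemma spectral_decomposition_smult:
  fixes A :: "real mat"
  assumes A: "A \<in> carrier_mat n n" and sd: "spectral_decomposition A U d"
  shows "spectral_decomposition (c \<cdot>\<^sub>m A) U (\<lambda>i. c * d i)"
proof -
  have U: "U \<in> carrier_mat n n" "transpose_mat U * U = 1\<^sub>m n" "U * transpose_mat U = 1\<^sub>m n"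
    "A = U * mat_diag n d * transpose_mat U"
    using sd A by (auto simp: spectral_decomposition_def)
  have "mat_diag n (\<lambda>i. c * d i) = c \<cdot>\<^sub>m mat_diag n d"
    by (rule eq_matI) (auto simp: mat_diag_def)
  then have "U * mat_diag n (\<lambda>i. c * d i) * transpose_mat U = c \<cdot>\<^sub>m A"
    using U(1) unfolding U(4)
    by (simp add: mult_smult_distrib[of _ n n _ n] mult_smult_assoc_mat[of _ n n _ n])
  then show ?thesis using A U by (simp add: spectral_decomposition_def)
qed

text \<open>With \<open>d = \<Lambda> t\<close> the definitions give
  \<open>r t \<cdot> t\<^sup>-\<^sup>\<beta> \<Lambda>\<^sup>-\<^sup>\<alpha> - d\<^sup>-\<^sup>\<alpha> = (r t - t\<^sup>\<beta>\<^sup>-\<^sup>\<alpha>) \<Lambda>\<^sup>\<beta>\<^sup>-\<^sup>\<alpha> d\<^sup>-\<^sup>\<beta>\<close> for the error in the eigendirection of \<open>d\<close>.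
  The factor \<open>d\<^sup>-\<^sup>\<beta>\<close>, squared, turns the weight \<open>d\<^sup>\<gamma>\<close> into that of the norm on the right.\<close>

lemma matrix_norm_error_le:
  fixes \<alpha> :: real and \<beta> :: nat
  assumes A: "spd_mat n A" and L: "\<Lambda> > 0" "\<And>\<mu>. eigenvalue A \<mu> \<Longrightarrow> \<mu> \<le> \<Lambda>"
    and ft: "ft \<in> carrier_vec n"
    and r: "\<And>t. t \<in> {0..1} \<Longrightarrow> \<bar>t powr (real \<beta> - \<alpha>) - r t\<bar> \<le> \<epsilon>"
  shows "matrix_norm A \<gamma>
       (matrix_fun r ((1 / \<Lambda>) \<cdot>\<^sub>m A) *\<^sub>v (matrix_powr ((1 / \<Lambda>) \<cdot>\<^sub>m A) (- real \<beta>) *\<^sub>v ((1 / \<Lambda> powr \<alpha>) \<cdot>\<^sub>v ft))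
        - matrix_powr A (- \<alpha>) *\<^sub>v ft)
     \<le> \<epsilon> * \<Lambda> powr (real \<beta> - \<alpha>) * matrix_norm A (\<gamma> - 2 * real \<beta>) ft"
proof -
  have Ac: "A \<in> carrier_mat n n" "transpose_mat A = A" using A by (auto simp: spd_mat_def)
  obtain U d where sd: "spectral_decomposition A U d" using symmetric_spectral_decomposition[OF Ac] by blast
  have U: "transpose_mat U \<in> carrier_mat n n" using sd Ac by (auto simp: spectral_decomposition_def)
  let ?A = "(1 / \<Lambda>) \<cdot>\<^sub>m A"
  have Ac': "?A \<in> carrier_mat n n" using Ac by simp
  have sd': "spectral_decomposition ?A U (\<lambda>i. 1 / \<Lambda> * d i)"
    by (rule spectral_decomposition_smult[OF Ac(1) sd])
  define f w u where "f = (1 / \<Lambda> powr \<alpha>) \<cdot>\<^sub>v ft" and "w = matrix_powr ?A (- real \<beta>) *\<^sub>v f" and "u = matrix_powr A (- \<alpha>) *\<^sub>v ft"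
  define g where "g = transpose_mat U *\<^sub>v ft"
  let ?e = "matrix_fun r ?A *\<^sub>v w - u"
  have f: "f \<in> carrier_vec n" using ft by (simp add: f_def)
  have w: "w \<in> carrier_vec n" and u: "u \<in> carrier_vec n" 
    unfolding w_def u_def matrix_powr_def
    using spectral_coordinate_matrix_fun(1)[OF Ac' sd' f] spectral_coordinate_matrix_fun(1)[OF Ac(1) sd ft] by auto
  have rw: "matrix_fun r ?A *\<^sub>v w \<in> carrier_vec n" by (rule spectral_coordinate_matrix_fun(1)[OF Ac' sd' w])
  have e: "?e \<in> carrier_vec n" using rw u by simp
  have nonneg: "\<epsilon> \<ge> 0" using r[of 0] by simp
  have coord: "((transpose_mat U *\<^sub>v ?e) $ i)\<^sup>2 * d i powr \<gamma> \<le> (\<epsilon> * \<Lambda> powr (real \<beta> - \<alpha>))\<^sup>2 * (d i powr (\<gamma> - 2 * real \<beta>) * (g $ i)\<^sup>2)"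
    if i: "i < n" for i
  proof -
    have d: "d i > 0" "d i \<le> \<Lambda>" using spd_mat_spectrum[OF A sd i] L(2) by auto
    define t where "t = 1 / \<Lambda> * d i"
    have t: "t > 0" "t \<le> 1" using d L by (auto simp: t_def)
    have dt: "d i = \<Lambda> * t" using L by (simp add: t_def)
    have "transpose_mat U *\<^sub>v f = (1 / \<Lambda> powr \<alpha>) \<cdot>\<^sub>v g"
      unfolding f_def g_def using U ft by (rule mult_mat_vec)
    then have fi: "(transpose_mat U *\<^sub>v f) $ i = 1 / \<Lambda> powr \<alpha> * g $ i"
      using i U by (simp add: g_def)
    have "transpose_mat U *\<^sub>v ?e = transpose_mat U *\<^sub>v (matrix_fun r ?A *\<^sub>v w) - transpose_mat U *\<^sub>v u"
      by (rule mult_minus_distrib_mat_vec[OF U rw u])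
    then have "(transpose_mat U *\<^sub>v ?e) $ i = (transpose_mat U *\<^sub>v (matrix_fun r ?A *\<^sub>v w)) $ i - (transpose_mat U *\<^sub>v u) $ i"
      using i U by simp
    also have "(transpose_mat U *\<^sub>v (matrix_fun r ?A *\<^sub>v w)) $ i = r t * (t powr (- real \<beta>) * (1 / \<Lambda> powr \<alpha> * g $ i))"
      unfolding spectral_coordinate_matrix_fun(2)[OF Ac' sd' w i] t_def[symmetric]
      unfolding w_def matrix_powr_def spectral_coordinate_matrix_fun(2)[OF Ac' sd' f i] t_def[symmetric] fi by simp
    also have "(transpose_mat U *\<^sub>v u) $ i = d i powr (- \<alpha>) * g $ i"
      unfolding u_def matrix_powr_def spectral_coordinate_matrix_fun(2)[OF Ac(1) sd ft i] g_def by simp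
    also have "d i powr (- \<alpha>) = t powr (- real \<beta>) * t powr (real \<beta> - \<alpha>) * (1 / \<Lambda> powr \<alpha>)"
    proof -
      have "t powr (- real \<beta>) * t powr (real \<beta> - \<alpha>) = t powr (- \<alpha>)" by (simp flip: powr_add)
      then show ?thesis using L t by (simp add: dt powr_mult powr_minus_divide)
    qed
    also have "r t * (t powr (- real \<beta>) * (1 / \<Lambda> powr \<alpha> * g $ i)) - t powr (- real \<beta>) * t powr (real \<beta> - \<alpha>) * (1 / \<Lambda> powr \<alpha>) * g $ i
       = - (t powr (real \<beta> - \<alpha>) - r t) * (t powr (- real \<beta>) * (1 / \<Lambda> powr \<alpha>)) * g $ i"
      by (simp add: algebra_simps diff_divide_distrib)
    also have "t powr (- real \<beta>) * (1 / \<Lambda> powr \<alpha>) = \<Lambda> powr (real \<beta> - \<alpha>) * d i powr (- real \<beta>)"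
      using L t by (simp add: dt powr_mult powr_diff powr_minus_divide)
    finally have E: "(transpose_mat U *\<^sub>v ?e) $ i = - (t powr (real \<beta> - \<alpha>) - r t) * (\<Lambda> powr (real \<beta> - \<alpha>) * d i powr (- real \<beta>)) * g $ i" .
    have "(t powr (real \<beta> - \<alpha>) - r t)\<^sup>2 \<le> \<epsilon>\<^sup>2"
      using r[of t] t nonneg by (simp add: abs_le_square_iff[symmetric])
    then have "(t powr (real \<beta> - \<alpha>) - r t)\<^sup>2 * ((\<Lambda> powr (real \<beta> - \<alpha>))\<^sup>2 * ((d i powr (- real \<beta>))\<^sup>2 * d i powr \<gamma>) * (g $ i)\<^sup>2)
       \<le> \<epsilon>\<^sup>2 * ((\<Lambda> powr (real \<beta> - \<alpha>))\<^sup>2 * ((d i powr (- real \<beta>))\<^sup>2 * d i powr \<gamma>) * (g $ i)\<^sup>2)"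
      by (intro mult_right_mono) auto
    moreover have pow: "(d i powr (- real \<beta>))\<^sup>2 * d i powr \<gamma> = d i powr (\<gamma> - 2 * real \<beta>)"
      by (simp add: power2_eq_square flip: powr_add)
    moreover have alg: "(- T * (l * D) * G)\<^sup>2 * Y = T\<^sup>2 * (l\<^sup>2 * (D\<^sup>2 * Y) * G\<^sup>2)" for T l D G Y :: real
      by (simp add: power_mult_distrib)
    ultimately show ?thesis unfolding E alg pow by (simp only: power_mult_distrib mult.assoc)
  qed
  have norm: "matrix_norm A \<gamma>' x = sqrt (\<Sum>i<n. d i powr \<gamma>' * ((transpose_mat U *\<^sub>v x) $ i)\<^sup>2)" if "x \<in> carrier_vec n" for x \<gamma>'
    unfolding matrix_norm_def matrix_powr_def spectral_coordinate_matrix_fun(3)[OF Ac(1) sd that] ..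
  have "matrix_norm A \<gamma> ?e \<le> sqrt (\<Sum>i<n. (\<epsilon> * \<Lambda> powr (real \<beta> - \<alpha>))\<^sup>2 * (d i powr (\<gamma> - 2 * real \<beta>) * (g $ i)\<^sup>2))"
    unfolding norm[OF e] using coord by (intro real_sqrt_le_mono sum_mono) (simp add: mult.commute)
  also have "\<dots> = \<epsilon> * \<Lambda> powr (real \<beta> - \<alpha>) * matrix_norm A (\<gamma> - 2 * real \<beta>) ft"
    unfolding norm[OF ft] sum_distrib_left[symmetric] real_sqrt_mult g_def[symmetric] using nonneg by simp
  finally show ?thesis by (simp only: f_def w_def u_def)
qed

theorem lemma2p3:
  fixes \<alpha> :: real and \<beta> :: nat
  assumes "0 < \<alpha>" and "\<alpha> < 1" and "\<beta> \<ge> 1"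
  shows "\<exists>(C::real) (k0::nat). C > 0 \<and> k0 \<ge> 1 \<and>
    (\<forall>(k::nat) (N::nat) (A::real mat) (\<Lambda>::real) (ft::real vec) (r::real \<Rightarrow> real) (\<gamma>::real).
      k \<ge> k0 \<longrightarrow> spd_mat N A \<longrightarrow> \<Lambda> > 0 \<longrightarrow> (\<forall>\<mu>. eigenvalue A \<mu> \<longrightarrow> \<mu> \<le> \<Lambda>) \<longrightarrow>
      ft \<in> carrier_vec N \<longrightarrow>
      best_rational_approx k k (\<lambda>t. t powr (real \<beta> - \<alpha>)) r \<longrightarrow>
      (let u = matrix_powr A (- \<alpha>) *\<^sub>v ft;
           A' = (1 / \<Lambda>) \<cdot>\<^sub>m A;
           f = (1 / \<Lambda> powr \<alpha>) \<cdot>\<^sub>v ft;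
           u\<^sub>r = matrix_fun r A' *\<^sub>v (matrix_powr A' (- real \<beta>) *\<^sub>v f)
       in matrix_norm A \<gamma> (u\<^sub>r - u)
          \<le> C * \<Lambda> powr (real \<beta> - \<alpha>) * exp (- 2 * pi * sqrt ((real \<beta> - \<alpha>) * real k))
            * matrix_norm A (\<gamma> - 2 * real \<beta>) ft))"
proof -
  let ?a = "real \<beta> - \<alpha>"
  have a: "?a > 0" using assms by linarith
  have "sin (pi * ?a) \<noteq> 0"
  proof
    assume "sin (pi * ?a) = 0"
    then obtain i :: int where "pi * ?a = of_int i * pi" by (auto simp: sin_zero_iff_int2)
    then have "?a = of_int i" by simp
    then have "\<alpha> = of_int (int \<beta> - i)" by simp
    then have "0 < int \<beta> - i" "int \<beta> - i < 1" using assms by linarith+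
    then show False by linarith
  qed
  from rational_approx_powr[OF a this] obtain C k0 where C: "C > 0" "k0 \<ge> 1"
    "\<And>k. k \<ge> k0 \<Longrightarrow> \<exists>s\<in>rational_functions k k. \<forall>x\<in>{0..1}. \<bar>x powr ?a - s x\<bar> \<le> C * exp (- 2 * pi * sqrt (?a * real k))"
    by blast
  have cont: "continuous_on {0..1} (\<lambda>t. t powr ?a)" using a by (intro continuous_on_powr') (auto intro: continuous_intros)
  show ?thesis
  proof (intro exI[of _ C] exI[of _ k0] conjI C(1,2) allI impI, unfold Let_def)
    fix k N :: nat and A :: "real mat" and \<Lambda> :: real and ft :: "real vec" and r :: "real \<Rightarrow> real" and \<gamma> :: real
    assume k: "k \<ge> k0" and A: "spd_mat N A" and L: "\<Lambda> > 0" "\<forall>\<mu>. eigenvalue A \<mu> \<longrightarrow> \<mu> \<le> \<Lambda>"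
      and ft: "ft \<in> carrier_vec N" and best: "best_rational_approx k k (\<lambda>t. t powr ?a) r"
    obtain s where s: "s \<in> rational_functions k k"
      "\<And>x. x \<in> {0..1} \<Longrightarrow> \<bar>x powr ?a - s x\<bar> \<le> C * exp (- 2 * pi * sqrt (?a * real k))"
      using C(3)[OF k] by blast
    have "\<bar>t powr ?a - r t\<bar> \<le> C * exp (- 2 * pi * sqrt (?a * real k))" if "t \<in> {0..1}" for t
      using best_rational_approx_error[OF best cont s that] .
    from matrix_norm_error_le[OF A L(1) _ ft this] L(2)
    show "matrix_norm A \<gamma> (matrix_fun r ((1 / \<Lambda>) \<cdot>\<^sub>m A) *\<^sub>v (matrix_powr ((1 / \<Lambda>) \<cdot>\<^sub>m A) (- real \<beta>) *\<^sub>v ((1 / \<Lambda> powr \<alpha>) \<cdot>\<^sub>v ft))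
        - matrix_powr A (- \<alpha>) *\<^sub>v ft)
      \<le> C * \<Lambda> powr ?a * exp (- 2 * pi * sqrt (?a * real k)) * matrix_norm A (\<gamma> - 2 * real \<beta>) ft"
      by (simp add: mult_ac)
  qed
qed

end
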